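(* Let $N := 2^n$ and let $\mathcal{F}$ be any family of tampering functions $f\colon \{0,1\}^n \to \{0,1\}^n$. For any $\epsilon, \eta > 0$, with probability at least $1-\eta$ over the randomness of the construction, the coding scheme $(\mathsf{Enc}, \mathsf{Dec})$ produced by the random sparse construction (described in the context) with parameters $n,k,t,\delta$ is a strong non-malleable code with respect to $\mathcal{F}$ with error $\epsilon$ and relative distance $\delta$, provided that both of the following conditions are satisfied. 1. $t \ge t_0$, for some $$t_0 = O\left(\frac{1}{\epsilon^6}\Big(\log\frac{|\mathcal{F}|N}{\eta}\Big)\right).$$ 2. $k \le k_0$, for some $$k_0 \ge n(1-h(\delta)) - \log t - 3\log(1/\epsilon) - O(1),$$ where $h(\cdot)$ denotes the binary entropy function. Thus by choosing $t = t_0$ and $k = k_0$, the construction satisfies $$k \ge n(1-h(\delta)) - \log\log(|\mathcal{F}|/\eta) - \log n - 9\log(1/\epsilon) - O(1).$$ In particular, if $|\mathcal{F}| \le 2^{2^{\alpha n}}$ for any constant $\alpha \in (0,1)$, the rate of the code can be made arbitrarily close to $1-h(\delta)-\alpha$ while allowing $\epsilon = 2^{-\Omega(n)}$.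
   Context: All logarithms are to base $2$. Two distributions are $\epsilon$-close (written $\approx_\epsilon$) if their statistical (total variation) distance is at most $\epsilon$. Coding scheme. A coding scheme with block length $n$ and message length $k\le n$ is a pair of functions $\mathsf{Enc}\colon \{0,1\}^k \to \{0,1\}^n$ and $\mathsf{Dec}\colon \{0,1\}^n \to \{0,1\}^k \cup \{\perp\}$, where $\mathsf{Enc}$ is randomized (so $\mathsf{Enc}(s)$ is a random variable, over uniform internal coin flips), $\mathsf{Dec}$ is deterministic, and for all $s\in\{0,1\}^k$, $\mathsf{Dec}(\mathsf{Enc}(s)) = s$ with probability $1$. Its rate is $k/n$. It has relative distance $\delta$ if for every $s$ and every nonzero $\Delta \in \{0,1\}^n$ of Hamming weight at most $\delta n$, $\mathsf{Dec}(\mathsf{Enc}(s) + \Delta) = \perp$ with probability $1$ (addition is bitwise mod 2). Strong non-malleability. A coding scheme is strong non-malleable with error $\epsilon$ with respect to a family $\mathcal{F}$ of functions $\{0,1\}^n\to\{0,1\}^n$ if the following holds for every $f\in\mathcal{F}$. For $s \in \{0,1\}^k$ let $E_s := \mathsf{Enc}(s)$, let $D_s := \mathsf{same}$ (a special symbol) if $f(E_s) = E_s$ and $D_s := \mathsf{Dec}(f(E_s))$ otherwise, and let $\mathcal{D}_{f,s}$ be the distribution of $D_s$. Then $\mathcal{D}_{f,s_1} \approx_\epsilon \mathcal{D}_{f,s_2}$ for all distinct $s_1,s_2\in\{0,1\}^k$. Random sparse construction. Parameters: integers $0<k\le n$ and $t>0$ with $t2^k\le 2^n$, and $0\le\delta<1/2$.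 Start with $\mathcal{N} := \{0,1\}^n$. For each $s \in \{0,1\}^k$, in an arbitrary order: set $E(s) := \emptyset$ and repeat $t$ times: pick $w\in\mathcal{N}$ uniformly at random, add $w$ to $E(s)$, and remove from $\mathcal{N}$ the Hamming ball of radius $\delta n$ centered at $w$ (for $\delta = 0$ this is just $\{w\}$). Then $\mathsf{Enc}(s)$ outputs a uniformly random element of $E(s)$, and $\mathsf{Dec}(w)$ outputs the unique $s$ with $w\in E(s)$, or $\perp$ if no such $s$ exists.
   Formalization: For ε>1 the construction is assumed never to exhaust its pool; the bound on k for t=t0, k=k0 (rounded) is stated for ε≤1, k>0, nonempty F, log(|F|/η)≥c>0, its O(1) depending on c (false as log(|F|/η)→0); the rate claim assumes 1-h(δ)-α>0. *)

theory Defs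
  imports "HOL-Probability.Probability"
begin

text \<open>The space $\{0,1\}^n$.\<close>

definition words :: "nat \<Rightarrow> bool list set" where
  "words n = {w. length w = n}"

definition weight :: "bool list \<Rightarrow> nat" where
  "weight w = card {i. i < length w \<and> w ! i}"

definition xor_word :: "bool list \<Rightarrow> bool list \<Rightarrow> bool list" (infixl "\<oplus>\<^sub>2" 65) where
  "v \<oplus>\<^sub>2 w = map2 (\<noteq>) v w"

definition hamming_ball :: "nat \<Rightarrow> real \<Rightarrow> bool list \<Rightarrow> bool list set" where
  "hamming_ball n r w = {v \<in> words n. real (weight (v \<oplus>\<^sub>2 w)) \<le> r}"

text \<open>At the endpoints this is $0$, because \<open>0 * log 2 0 = 0\<close>.\<close>

definition binary_entropy :: "real \<Rightarrow> real" where
  "binary_entropy x = - x * log 2 x - (1 - x) * log 2 (1 - x)"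

definition tv_dist :: "'a pmf \<Rightarrow> 'a pmf \<Rightarrow> real" where
  "tv_dist p q = (SUP A. \<bar>measure_pmf.prob p A - measure_pmf.prob q A\<bar>)"

text \<open>
  A randomized encoder is given by the output distribution for each message; \<open>None\<close> is the
  decoder's failure symbol.
\<close>

type_synonym encoder = "bool list \<Rightarrow> bool list pmf"
type_synonym decoder = "bool list \<Rightarrow> bool list option"

definition coding_scheme :: "nat \<Rightarrow> nat \<Rightarrow> encoder \<Rightarrow> decoder \<Rightarrow> bool" where
  "coding_scheme n k Enc Dec \<longleftrightarrow>
     k \<le> n \<and>
     (\<forall>s\<in>words k. set_pmf (Enc s) \<subseteq> words n) \<and>
     (\<forall>w\<in>words n. Dec w \<in> insert None (Some ` words k)) \<and>
     (\<forall>s\<in>words k. measure_pmf.prob (Enc s) {w. Dec w = Some s} = 1)"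

definition has_relative_distance ::
    "nat \<Rightarrow> nat \<Rightarrow> real \<Rightarrow> encoder \<Rightarrow> decoder \<Rightarrow> bool" where
  "has_relative_distance n k \<delta> Enc Dec \<longleftrightarrow>
     (\<forall>s\<in>words k. \<forall>\<Delta>\<in>words n. \<Delta> \<noteq> replicate n False \<and> real (weight \<Delta>) \<le> \<delta> * real n \<longrightarrow>
        measure_pmf.prob (Enc s) {w. Dec (w \<oplus>\<^sub>2 \<Delta>) = None} = 1)"

datatype tamper_result = Same | Decoded "bool list option"

definition tamper_dist ::
    "encoder \<Rightarrow> decoder \<Rightarrow> (bool list \<Rightarrow> bool list) \<Rightarrow> bool list \<Rightarrow> tamper_result pmf" where
  "tamper_dist Enc Dec f s =
     map_pmf (\<lambda>w. if f w = w then Same else Decoded (Dec (f w))) (Enc s)"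

definition strong_non_malleable ::
    "nat \<Rightarrow> real \<Rightarrow> (bool list \<Rightarrow> bool list) set \<Rightarrow> encoder \<Rightarrow> decoder \<Rightarrow> bool" where
  "strong_non_malleable k \<epsilon> F Enc Dec \<longleftrightarrow>
     (\<forall>f\<in>F. \<forall>s1\<in>words k. \<forall>s2\<in>words k. s1 \<noteq> s2 \<longrightarrow>
        tv_dist (tamper_dist Enc Dec f s1) (tamper_dist Enc Dec f s2) \<le> \<epsilon>)"

text \<open>
  Families of functions on $\{0,1\}^n$ are sets of extensional functions, so that \<open>card\<close> counts
  each function once.
\<close>

definition tampering_family :: "nat \<Rightarrow> (bool list \<Rightarrow> bool list) set \<Rightarrow> bool" where
  "tampering_family n F \<longleftrightarrow> F \<subseteq> words n \<rightarrow>\<^sub>E words n"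

definition admissible :: "nat \<Rightarrow> nat \<Rightarrow> nat \<Rightarrow> bool" where
  "admissible n k t \<longleftrightarrow> 0 < k \<and> k \<le> n \<and> 0 < t \<and> t * 2 ^ k \<le> 2 ^ n"

text \<open>
  The sampling is a subprobability distribution: \<open>spmf_of_set {}\<close> is the failing computation, so
  a run that exhausts the pool $\mathcal{N}$ carries no mass and is never counted as a success.
  The function \<open>draw_codewords\<close> returns the remaining pool together with the set $E(s)$, starting
  from pool \<open>P\<close> and the elements \<open>A\<close> of $E(s)$ drawn so far.
\<close>

primrec draw_codewords ::
    "nat \<Rightarrow> real \<Rightarrow> nat \<Rightarrow> bool list set \<Rightarrow> bool list set \<Rightarrow> (bool list set \<times> bool list set) spmf" where
  "draw_codewords n \<delta> 0 P A = return_spmf (P, A)"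
| "draw_codewords n \<delta> (Suc t) P A =
     bind_spmf (spmf_of_set P)
       (\<lambda>w. draw_codewords n \<delta> t (P - hamming_ball n (\<delta> * real n) w) (insert w A))"

text \<open>The list argument is the order in which the messages are processed.\<close>

primrec draw_code ::
    "nat \<Rightarrow> real \<Rightarrow> nat \<Rightarrow> bool list list \<Rightarrow> bool list set \<Rightarrow> (bool list \<Rightarrow> bool list set) spmf" where
  "draw_code n \<delta> t [] P = return_spmf (\<lambda>_. {})"
| "draw_code n \<delta> t (s # ss) P =
     bind_spmf (draw_codewords n \<delta> t P {})
       (\<lambda>(P', A). map_spmf (\<lambda>E. E(s := A)) (draw_code n \<delta> t ss P'))"

definition sparse_construction ::
    "nat \<Rightarrow> real \<Rightarrow> nat \<Rightarrow> bool list list \<Rightarrow> (bool list \<Rightarrow> bool list set) spmf" where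
  "sparse_construction n \<delta> t ss = draw_code n \<delta> t ss (words n)"

definition message_order :: "nat \<Rightarrow> bool list list \<Rightarrow> bool" where
  "message_order k ss \<longleftrightarrow> distinct ss \<and> set ss = words k"

definition sparse_enc :: "(bool list \<Rightarrow> bool list set) \<Rightarrow> encoder" where
  "sparse_enc E s = pmf_of_set (E s)"

definition sparse_dec :: "(bool list \<Rightarrow> bool list set) \<Rightarrow> decoder" where
  "sparse_dec E w = (if \<exists>!s. w \<in> E s then Some (THE s. w \<in> E s) else None)"

definition success_prob ::
    "nat \<Rightarrow> nat \<Rightarrow> nat \<Rightarrow> real \<Rightarrow> bool list list \<Rightarrow> (bool list \<Rightarrow> bool list) set \<Rightarrow> real \<Rightarrow> real" where
  "success_prob n k t \<delta> ss F \<epsilon> =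
     measure (measure_spmf (sparse_construction n \<delta> t ss))
       {E. coding_scheme n k (sparse_enc E) (sparse_dec E) \<and>
           strong_non_malleable k \<epsilon> F (sparse_enc E) (sparse_dec E) \<and>
           has_relative_distance n k \<delta> (sparse_enc E) (sparse_dec E)}"

end

theory Submission
  imports Defs "HOL-Real_Asymp.Real_Asymp"
begin

text \<open>
  A code is a list of \<open>t * 2 ^ k\<close> words drawn one after the other, each uniform on a pool that
  contains all but a small fraction of the space; hence a Chernoff bound holds for any
  history-dependent statistic whose conditional mean over the whole space is small.

  Fix a tampering function \<open>f\<close>. A value is heavy if it has many preimages; there are few heavy values.
  For a codeword \<open>w\<close> record whether it is fixed by \<open>f\<close>, which heavy value \<open>f w\<close> is, or
  merely that \<open>f w\<close> is light. This classification does not depend on the code, so by a union bound over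
  sets of classes every message sees nearly the same distribution of classes. It
  determines the tampered decoding unless \<open>f w\<close> is light and hits another codeword, and such
  collisions are rare: with codewords drawn before \<open>w\<close>, because the preimages of the light part of the
  code have small mass; with codewords drawn after \<open>w\<close>, because each new codeword is unlikely to
  meet the images of the block of \<open>w\<close>, once those hit more than \<open>K\<close> times are set aside.
\<close>

section \<open>Sequential sampling\<close>

text \<open>The law of the tampered decoding refers to the decoder, which depends on the whole code,
  so there is no fixed mean to concentrate around. This is why classes are code-independent and all
  sets of classes are controlled at once: an event about the decoding pulls back to a set of classes
  that may depend on the code, yet the union bound covers it. That bound costs a factor 2^(r+2),
  where a value is heavy if more than a fraction 1/r of the space is moved onto it. The factor must
  be beaten by exp(-\<epsilon>^2 t / 1024), so t has to exceed r / \<epsilon>^2 by a constant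
  factor. Collisions with later codewords bound r from below: with a cap K of order t / (r
  \<epsilon>) their tail exponent is of order (t / K) \<epsilon>, that is r \<epsilon>^2, and it
  must exceed a multiple of L, the logarithm of |F| 2^n / \<eta>. Hence r is of order L /
  \<epsilon>^2 and t of order L / \<epsilon>^4. Of the error \<epsilon> / 2 allowed to each message,
  \<epsilon> / 8 goes to class counts and 3 \<epsilon> / 8 to collisions.\<close>

lemma measure_bind_spmf_of_set:
  assumes "finite A"
  shows "measure (measure_spmf (bind_spmf (spmf_of_set A) k)) X
       = (\<Sum>w\<in>A. measure (measure_spmf (k w)) X) / card A"
proof -
  have "measure (measure_spmf (bind_spmf (spmf_of_set A) k)) X
      = (\<integral>w. measure (measure_spmf (k w)) X \<partial>measure_spmf (spmf_of_set A))"
    by (simp add: measure_spmf_bind o_def measure_spmf.measure_bind[where N="count_space UNIV"])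
  then show ?thesis
    by (simp add: integral_spmf_of_set)
qed

text \<open>The state is the full history, from which \<open>G\<close> computes the current pool.
  Keeping the history lets a statistic of the next draw refer to everything drawn before.\<close>

primrec draws :: "('a list \<Rightarrow> 'a set) \<Rightarrow> nat \<Rightarrow> 'a list \<Rightarrow> 'a list spmf" where
  "draws G 0 h = return_spmf h"
| "draws G (Suc m) h = bind_spmf (spmf_of_set (G h)) (\<lambda>w. draws G m (h @ [w]))"

lemma draws_add: "draws G (m + m') h = bind_spmf (draws G m h) (draws G m')"
  by (induction m arbitrary: h) simp_all

text \<open>The prefix \<open>take i xs\<close> is the history at which entry \<open>i\<close> was
  drawn; this turns facts about runs into facts about lists.\<close>

lemma draws_support:
  assumes "xs \<in> set_spmf (draws G m h)"
  shows "length xs = length h + m" "take (length h) xs = h"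
    "\<And>i. length h \<le> i \<Longrightarrow> i < length xs \<Longrightarrow> xs ! i \<in> G (take i xs)"
proof -
  have "length xs = length h + m \<and> take (length h) xs = h \<and>
    (\<forall>i. length h \<le> i \<longrightarrow> i < length xs \<longrightarrow> xs ! i \<in> G (take i xs))"
    using assms
  proof (induction m arbitrary: h)
    case 0
    then show ?case by simp
  next
    case (Suc m)
    then obtain w where w: "w \<in> set_spmf (spmf_of_set (G h))" "xs \<in> set_spmf (draws G m (h @ [w]))"
      by (auto simp: set_bind_spmf)
    have wG: "w \<in> G h" using w(1) by (auto simp: set_spmf_of_set split: if_splits)
    note IH = Suc.IH[OF w(2)]
    have len: "length xs = Suc (length h + m)" using IH by simp
    have tk: "take (Suc (length h)) xs = h @ [w]" using IH by simp
    have th: "take (length h) xs = h"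
      using tk by (metis append_eq_conv_conj butlast_snoc butlast_take len diff_Suc_1 le_add1 Suc_le_mono)
    have nh: "xs ! length h = w"
      using tk by (metis lessI nth_append_length nth_take)
    show ?case
    proof (intro conjI allI impI)
      fix i assume i: "length h \<le> i" "i < length xs"
      show "xs ! i \<in> G (take i xs)"
        using IH i th nh wG by (cases "i = length h") auto
    qed (use len th in auto)
  qed
  then show "length xs = length h + m" "take (length h) xs = h"
    "\<And>i. length h \<le> i \<Longrightarrow> i < length xs \<Longrightarrow> xs ! i \<in> G (take i xs)" by auto
qed

text \<open>\<open>\<kappa>\<close> bounds the fraction of the space removed during the first
  \<open>T\<close> draws. With \<open>\<kappa> \<le> 1/2\<close> no pool is empty, and averaging
  over a pool instead of \<open>U\<close> costs a factor of at most 2.\<close>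

locale sequential_sampling =
  fixes U :: "'a set" and G :: "'a list \<Rightarrow> 'a set" and T :: nat and \<kappa> :: real
  assumes finite_U: "finite U" and U_ne: "U \<noteq> {}" and G_subset: "G h \<subseteq> U"
    and card_G: "set h \<subseteq> U \<Longrightarrow> length h < T \<Longrightarrow> (1 - \<kappa>) * card U \<le> card (G h)"
    and \<kappa>_nonneg: "0 \<le> \<kappa>" and \<kappa>_le: "\<kappa> \<le> 1/2"
begin

lemma finite_G: "finite (G h)"
  using G_subset finite_U finite_subset by blast

lemma card_U_pos: "0 < card U"
  using finite_U U_ne by (simp add: card_gt_0_iff)

lemma card_G_pos:
  assumes "set h \<subseteq> U" "length h < T"
  shows "0 < card (G h)"
proof -
  have "0 < (1 - \<kappa>) * card U" using \<kappa>_le card_U_pos by simp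
  then show ?thesis using card_G[OF assms] by linarith
qed

lemma lossless_draws:
  assumes "set h \<subseteq> U" "length h + m \<le> T"
  shows "lossless_spmf (draws G m h)"
  using assms
proof (induction m arbitrary: h)
  case (Suc m)
  then show ?case
    using card_G_pos[of h] finite_G[of h] G_subset[of h] by (auto simp: card_gt_0_iff)
qed simp

lemma draws_in_U:
  assumes "xs \<in> set_spmf (draws G m [])"
  shows "set xs \<subseteq> U"
  using draws_support(3)[OF assms] G_subset by (force simp: set_conv_nth)

text \<open>On [0,1] one has exp y \<le> 1 + y + y^2, and z^2 \<le> z makes the bound linear in z.
  The mean over the pool exceeds the mean over \<open>U\<close> by a factor of at most 1 / (1 -
  \<kappa>), and 1 + y \<le> exp y closes the estimate.\<close>

lemma mean_exp_le:
  fixes z :: "'a \<Rightarrow> real" and \<nu> :: real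
  assumes h: "set h \<subseteq> U" "length h < T"
    and z: "\<And>x. x \<in> U \<Longrightarrow> 0 \<le> z x \<and> z x \<le> 1"
    and \<nu>: "(\<Sum>x\<in>U. z x) \<le> \<nu> * card U" and \<theta>: "0 < \<theta>" "\<theta> \<le> 1"
  shows "(\<Sum>x\<in>G h. exp (\<theta> * z x)) / card (G h) \<le> exp ((\<theta> + \<theta>\<^sup>2) / (1 - \<kappa>) * \<nu>)"
proof -
  define g where "g = real (card (G h))"
  have gpos: "g > 0" using card_G_pos[OF h] by (simp add: g_def)
  have gge: "(1 - \<kappa>) * card U \<le> g" using card_G[OF h] by (simp add: g_def)
  have k1: "0 < 1 - \<kappa>" using \<kappa>_le by simp
  have cU: "0 < real (card U)" using card_U_pos by simp
  have "0 \<le> (\<Sum>x\<in>U. z x)" using z by (simp add: sum_nonneg)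
  then have "0 \<le> \<nu> * card U" using \<nu> by simp
  then have \<nu>0: "0 \<le> \<nu>" using cU by (simp add: zero_le_mult_iff)
  have e: "exp (\<theta> * z x) \<le> 1 + (\<theta> + \<theta>\<^sup>2) * z x" if "x \<in> U" for x
  proof -
    have "exp (\<theta> * z x) \<le> 1 + \<theta> * z x + (\<theta> * z x)\<^sup>2"
      using z[OF that] \<theta> by (intro exp_bound) (auto simp: mult_le_one)
    also have "(\<theta> * z x)\<^sup>2 = \<theta>\<^sup>2 * (z x * z x)" by (simp add: power2_eq_square)
    also have "\<dots> \<le> \<theta>\<^sup>2 * z x"
      using z[OF that] by (intro mult_left_mono) (auto simp: mult_left_le)
    finally show ?thesis by (simp add: algebra_simps)
  qed
  have "(\<Sum>x\<in>G h. exp (\<theta> * z x)) \<le> (\<Sum>x\<in>G h. 1 + (\<theta> + \<theta>\<^sup>2) * z x)"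
    using e G_subset by (intro sum_mono) blast
  also have "\<dots> = g + (\<theta> + \<theta>\<^sup>2) * (\<Sum>x\<in>G h. z x)"
    by (simp add: sum.distrib sum_distrib_left g_def)
  also have "\<dots> \<le> g + (\<theta> + \<theta>\<^sup>2) * (\<nu> * (g / (1 - \<kappa>)))"
  proof -
    have "(\<Sum>x\<in>G h. z x) \<le> (\<Sum>x\<in>U. z x)"
      using z G_subset finite_U by (intro sum_mono2) auto
    also have "\<dots> \<le> \<nu> * card U" by (rule \<nu>)
    also have "\<dots> \<le> \<nu> * (g / (1 - \<kappa>))"
      using gge k1 by (intro mult_left_mono \<nu>0) (simp add: field_simps)
    finally show ?thesis
      using \<theta> by (intro add_left_mono mult_left_mono) auto
  qed
  finally have "(\<Sum>x\<in>G h. exp (\<theta> * z x)) / g \<le> 1 + (\<theta> + \<theta>\<^sup>2) / (1 - \<kappa>) * \<nu>"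
    using gpos by (simp add: field_simps)
  also have "\<dots> \<le> exp ((\<theta> + \<theta>\<^sup>2) / (1 - \<kappa>) * \<nu>)" by (rule exp_ge_add_one_self)
  finally show ?thesis by (simp add: g_def)
qed

text \<open>Induction on the number of remaining draws, for every history and threshold: the next
  word \<open>w\<close> lowers the threshold by \<open>z h w\<close>, and averaging the resulting
  factor \<open>exp (\<theta> * z h w)\<close> over the pool is the exponential moment above.
  Markov's inequality is hidden in the base case, where the event is \<open>a \<le> 0\<close> and
  the bound is \<open>exp (- \<theta> * a)\<close>.\<close>

lemma chernoff_aux:
  fixes z :: "'a list \<Rightarrow> 'a \<Rightarrow> real" and \<nu> :: "nat \<Rightarrow> real"
  assumes h: "set h \<subseteq> U" "length h + m \<le> T"
    and z: "\<And>h x. 0 \<le> z h x \<and> z h x \<le> 1"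
    and \<nu>: "\<And>h. set h \<subseteq> U \<Longrightarrow> length h < T \<Longrightarrow> (\<Sum>x\<in>U. z h x) \<le> \<nu> (length h) * card U"
    and \<theta>: "0 < \<theta>" "\<theta> \<le> 1"
  shows "measure (measure_spmf (draws G m h))
      {xs. a \<le> (\<Sum>i=length h..<length h + m. z (take i xs) (xs ! i))}
    \<le> exp ((\<theta> + \<theta>\<^sup>2) / (1 - \<kappa>) * (\<Sum>i=length h..<length h + m. \<nu> i) - \<theta> * a)"
  using h
proof (induction m arbitrary: h a)
  case 0
  show ?case
  proof (cases "a \<le> 0")
    case True
    then have "0 \<le> - (\<theta> * a)" using \<theta> by (simp add: mult_le_0_iff)
    then have "1 \<le> exp (- (\<theta> * a))" by simp
    then show ?thesis
      by (auto intro: order_trans[OF measure_spmf.subprob_measure_le_1])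
  qed simp
next
  case (Suc m)
  let ?c = "(\<theta> + \<theta>\<^sup>2) / (1 - \<kappa>)"
  let ?S = "\<lambda>xs. \<Sum>i=length h..<length h + Suc m. z (take i xs) (xs ! i)"
  let ?R = "\<lambda>xs. \<Sum>i=Suc (length h)..<Suc (length h) + m. z (take i xs) (xs ! i)"
  let ?n = "length h"
  define Q where "Q = (\<Sum>i=Suc ?n..<Suc ?n + m. \<nu> i)"
  have hl: "?n < T" using Suc.prems by simp
  have step: "measure (measure_spmf (draws G m (h @ [w]))) {xs. a \<le> ?S xs}
     \<le> exp (?c * Q - \<theta> * a) * exp (\<theta> * z h w)" if w: "w \<in> G h" for w
  proof -
    have eq: "?S xs = z h w + ?R xs" if "xs \<in> set_spmf (draws G m (h @ [w]))" for xs
    proof -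
      note s = draws_support[OF that]
      have tk: "take (Suc ?n) xs = h @ [w]" using s(2) by simp
      have th: "take ?n xs = h"
        using tk s(1) by (metis append_eq_conv_conj take_take min.absorb1 le_add2 plus_1_eq_Suc)
      have nh: "xs ! ?n = w" using tk by (metis lessI nth_append_length nth_take)
      have "?S xs = z (take ?n xs) (xs ! ?n) + ?R xs"
        by (subst sum.atLeast_Suc_lessThan) auto
      then show ?thesis using th nh by simp
    qed
    have "measure (measure_spmf (draws G m (h @ [w]))) {xs. a \<le> ?S xs}
        = measure (measure_spmf (draws G m (h @ [w]))) {xs. a - z h w \<le> ?R xs}"
    proof (rule measure_spmf.finite_measure_eq_AE)
      show "AE xs in measure_spmf (draws G m (h @ [w])).
          xs \<in> {xs. a \<le> ?S xs} \<longleftrightarrow> xs \<in> {xs. a - z h w \<le> ?R xs}"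
        by (rule AE_measure_spmf_iff[THEN iffD2], rule ballI, unfold mem_Collect_eq eq) linarith
    qed auto
    also have "\<dots> \<le> exp (?c * Q - \<theta> * (a - z h w))"
    proof -
      have "w \<in> U" using w G_subset by blast
      then have "set (h @ [w]) \<subseteq> U" "length (h @ [w]) + m \<le> T"
        using Suc.prems by auto
      from Suc.IH[OF this, of "a - z h w"] show ?thesis
        by (simp only: Q_def length_append_singleton)
    qed
    also have "\<dots> = exp (?c * Q - \<theta> * a) * exp (\<theta> * z h w)"
      by (simp add: exp_add[symmetric] algebra_simps)
    finally show ?thesis .
  qed
  have "measure (measure_spmf (draws G (Suc m) h)) {xs. a \<le> ?S xs}
     = (\<Sum>w\<in>G h. measure (measure_spmf (draws G m (h @ [w]))) {xs. a \<le> ?S xs}) / card (G h)"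
    by (simp only: draws.simps measure_bind_spmf_of_set[OF finite_G])
  also have "\<dots> \<le> (\<Sum>w\<in>G h. exp (?c * Q - \<theta> * a) * exp (\<theta> * z h w)) / card (G h)"
    by (intro divide_right_mono sum_mono step) auto
  also have "\<dots> = exp (?c * Q - \<theta> * a) * ((\<Sum>w\<in>G h. exp (\<theta> * z h w)) / card (G h))"
    by (simp add: sum_distrib_left)
  also have "\<dots> \<le> exp (?c * Q - \<theta> * a) * exp (?c * \<nu> ?n)"
    using Suc.prems hl z \<nu> \<theta> by (intro mult_left_mono mean_exp_le) auto
  also have "\<dots> = exp (?c * (\<Sum>i=?n..<?n + Suc m. \<nu> i) - \<theta> * a)"
    unfolding Q_def by (subst (2) sum.atLeast_Suc_lessThan) (auto simp: exp_add[symmetric] algebra_simps)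
  finally show ?case .
qed

lemma chernoff:
  fixes z :: "'a list \<Rightarrow> 'a \<Rightarrow> real" and \<nu> :: "nat \<Rightarrow> real"
  assumes z: "\<And>h x. 0 \<le> z h x \<and> z h x \<le> 1"
    and \<nu>: "\<And>h. set h \<subseteq> U \<Longrightarrow> length h < T \<Longrightarrow> (\<Sum>x\<in>U. z h x) \<le> \<nu> (length h) * card U"
    and \<theta>: "0 < \<theta>" "\<theta> \<le> 1"
    and M: "(\<theta> + \<theta>\<^sup>2) / (1 - \<kappa>) * (\<Sum>i<T. \<nu> i) - \<theta> * a \<le> b"
  shows "measure (measure_spmf (draws G T [])) {xs. a \<le> (\<Sum>i<T. z (take i xs) (xs ! i))} \<le> exp b"
  using chernoff_aux[of "[]" T z \<nu> \<theta> a] assms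
  by (auto simp: atLeast0LessThan intro: order_trans)

text \<open>The version for thresholds well above the mean: at \<open>\<theta> = 1\<close> the
  coefficient (\<theta> + \<theta>^2) / (1 - \<kappa>) is at most 4.\<close>

lemma chernoff_unit:
  fixes z :: "'a list \<Rightarrow> 'a \<Rightarrow> real" and \<nu> :: "nat \<Rightarrow> real"
  assumes z: "\<And>h x. 0 \<le> z h x \<and> z h x \<le> 1"
    and \<nu>: "\<And>h. set h \<subseteq> U \<Longrightarrow> length h < T \<Longrightarrow> (\<Sum>x\<in>U. z h x) \<le> \<nu> (length h) * card U"
    and \<nu>0: "\<And>i. 0 \<le> \<nu> i"
    and M: "4 * (\<Sum>i<T. \<nu> i) - a \<le> b"
  shows "measure (measure_spmf (draws G T [])) {xs. a \<le> (\<Sum>i<T. z (take i xs) (xs ! i))} \<le> exp b"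
proof (rule chernoff[where z = z and \<nu> = \<nu> and \<theta> = 1])
  have "(1 + 1\<^sup>2) / (1 - \<kappa>) \<le> 4" using \<kappa>_le by (simp add: field_simps)
  then have "(1 + 1\<^sup>2) / (1 - \<kappa>) * (\<Sum>i<T. \<nu> i) \<le> 4 * (\<Sum>i<T. \<nu> i)"
    using \<nu>0 by (intro mult_right_mono sum_nonneg) auto
  then show "(1 + 1\<^sup>2) / (1 - \<kappa>) * (\<Sum>i<T. \<nu> i) - 1 * a \<le> b" using M by simp
qed (use z \<nu> in auto)

end

section \<open>Hamming balls and the sampled code\<close>

lemma finite_words: "finite (words n)"
  and card_words: "card (words n) = 2 ^ n"
  using finite_lists_length_eq[of "UNIV :: bool set" n] card_lists_length_eq[of "UNIV :: bool set" n]
  by (simp_all add: words_def)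

lemma length_xor_word [simp]: "length (v \<oplus>\<^sub>2 w) = min (length v) (length w)"
  by (simp add: xor_word_def)

lemma nth_xor_word: "length v = length w \<Longrightarrow> i < length w \<Longrightarrow> (v \<oplus>\<^sub>2 w) ! i \<longleftrightarrow> v ! i \<noteq> w ! i"
  by (simp add: xor_word_def)

lemma xor_word_commute: "length v = length w \<Longrightarrow> v \<oplus>\<^sub>2 w = w \<oplus>\<^sub>2 v"
  by (rule nth_equalityI) (auto simp: nth_xor_word)

lemma xor_word_cancel: "length \<Delta> = length w \<Longrightarrow> (w \<oplus>\<^sub>2 \<Delta>) \<oplus>\<^sub>2 w = \<Delta>"
  by (rule nth_equalityI) (auto simp: nth_xor_word)

lemma weight_xor_word:
  "length v = length w \<Longrightarrow> weight (v \<oplus>\<^sub>2 w) = card {i. i < length w \<and> v ! i = (\<not> w ! i)}"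
  unfolding weight_def by (intro arg_cong[of _ _ card]) (auto simp: nth_xor_word)

lemma hamming_ball_commute:
  "v \<in> words n \<Longrightarrow> w \<in> words n \<Longrightarrow> v \<in> hamming_ball n r w \<longleftrightarrow> w \<in> hamming_ball n r v"
  by (auto simp: hamming_ball_def words_def xor_word_commute)

lemma center_in_hamming_ball: "w \<in> words n \<Longrightarrow> 0 \<le> r \<Longrightarrow> w \<in> hamming_ball n r w"
  by (simp add: hamming_ball_def words_def weight_xor_word)

text \<open>A word is determined by the set of positions where it differs from the centre.\<close>

lemma card_hamming_ball_le_binomial:
  assumes "w \<in> words n"
  shows "card (hamming_ball n r w) \<le> (\<Sum>i | i \<le> n \<and> real i \<le> r. n choose i)"
proof -
  let ?D = "\<lambda>v. {i. i < n \<and> v ! i \<noteq> w ! i}"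
  let ?I = "{i. i \<le> n \<and> real i \<le> r}"
  have len: "length w = n" using assms by (simp add: words_def)
  have inj: "inj_on ?D (hamming_ball n r w)"
  proof (rule inj_onI)
    fix u v assume uv: "u \<in> hamming_ball n r w" "v \<in> hamming_ball n r w" and eq: "?D u = ?D v"
    show "u = v"
    proof (rule nth_equalityI)
      show "length u = length v" using uv by (simp add: hamming_ball_def words_def)
      fix i assume "i < length u"
      then have "i < n" using uv by (simp add: hamming_ball_def words_def)
      then show "u ! i = v ! i" using eq by blast
    qed
  qed
  have sub: "?D ` hamming_ball n r w \<subseteq> (\<Union>i\<in>?I. {A. A \<subseteq> {..<n} \<and> card A = i})"
  proof
    fix A assume "A \<in> ?D ` hamming_ball n r w"
    then obtain v where v: "v \<in> hamming_ball n r w" "A = ?D v" by blast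
    have s: "A \<subseteq> {..<n}" using v by auto
    then have "card A \<le> n" using card_mono[of "{..<n}" A] by simp
    moreover have "real (card A) \<le> r"
      using v len by (auto simp: hamming_ball_def words_def weight_xor_word)
    ultimately show "A \<in> (\<Union>i\<in>?I. {A. A \<subseteq> {..<n} \<and> card A = i})" using s by blast
  qed
  have fin: "finite (\<Union>i\<in>?I. {A. A \<subseteq> {..<n} \<and> card A = i})"
    by (rule finite_subset[of _ "Pow {..<n}"]) auto
  have "card (hamming_ball n r w) = card (?D ` hamming_ball n r w)"
    using card_image[OF inj] by simp
  also have "\<dots> \<le> card (\<Union>i\<in>?I. {A. A \<subseteq> {..<n} \<and> card A = i})"
    by (rule card_mono[OF fin sub])
  also have "\<dots> \<le> (\<Sum>i\<in>?I. card {A. A \<subseteq> {..<n} \<and> card A = i})"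
    by (rule card_UN_le) simp
  also have "\<dots> = (\<Sum>i\<in>?I. n choose i)"
    by (simp add: n_subsets)
  finally show ?thesis .
qed

text \<open>The terms of the expansion of (\<delta> + (1 - \<delta>))^n sum to 1. Since \<delta> <
  1/2, the weight \<delta>^i (1 - \<delta>)^(n-i) decreases in i, so for i \<le> \<delta> n it is at
  least its value at \<delta> n, which is 2^(-n h(\<delta>)).\<close>

lemma binomial_tail_le_entropy:
  assumes "0 \<le> \<delta>" "\<delta> < 1/2"
  shows "real (\<Sum>i | i \<le> n \<and> real i \<le> \<delta> * n. n choose i) \<le> 2 powr (n * binary_entropy \<delta>)"
proof (cases "\<delta> = 0")
  case True
  then have "{i. i \<le> n \<and> real i \<le> \<delta> * n} = {0}" by auto
  then show ?thesis using True by (simp add: binary_entropy_def)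
next
  case False
  then have d: "0 < \<delta>" using assms by simp
  let ?I = "{i. i \<le> n \<and> real i \<le> \<delta> * n}"
  have pw: "2 powr (- (n * binary_entropy \<delta>)) = exp (\<delta> * n * ln \<delta> + (n - \<delta> * n) * ln (1 - \<delta>))"
    by (simp add: powr_def binary_entropy_def log_def field_simps)
  have le: "2 powr (- (n * binary_entropy \<delta>)) \<le> \<delta> ^ i * (1 - \<delta>) ^ (n - i)" if i: "i \<in> ?I" for i
  proof -
    have "\<delta> ^ i * (1 - \<delta>) ^ (n - i) = exp (i * ln \<delta> + (real n - i) * ln (1 - \<delta>))"
    proof -
      have "exp (i * ln \<delta>) = \<delta> ^ i" "exp (real (n - i) * ln (1 - \<delta>)) = (1 - \<delta>) ^ (n - i)"
        using d assms by (simp_all only: exp_of_nat_mult exp_ln)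
      then show ?thesis using i by (simp add: exp_add of_nat_diff)
    qed
    moreover have "0 \<le> (real i - \<delta> * n) * (ln \<delta> - ln (1 - \<delta>))"
      using i d assms by (intro mult_nonpos_nonpos) auto
    ultimately show ?thesis unfolding pw by (simp add: algebra_simps)
  qed
  have "2 powr (- (n * binary_entropy \<delta>)) * real (\<Sum>i\<in>?I. n choose i)
      = (\<Sum>i\<in>?I. (n choose i) * 2 powr (- (n * binary_entropy \<delta>)))"
    by (simp add: sum_distrib_left mult.commute)
  also have "\<dots> \<le> (\<Sum>i\<in>?I. (n choose i) * (\<delta> ^ i * (1 - \<delta>) ^ (n - i)))"
    by (intro sum_mono mult_left_mono le) auto
  also have "\<dots> \<le> (\<Sum>i\<le>n. (n choose i) * (\<delta> ^ i * (1 - \<delta>) ^ (n - i)))"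
    using d assms by (intro sum_mono2) auto
  also have "\<dots> = (\<delta> + (1 - \<delta>)) ^ n"
    by (subst binomial_ring) (simp add: mult.assoc)
  finally show ?thesis by (simp add: powr_minus divide_simps mult.commute)
qed

lemma card_hamming_ball_le:
  assumes "w \<in> words n" "0 \<le> \<delta>" "\<delta> < 1/2"
  shows "real (card (hamming_ball n (\<delta> * n) w)) \<le> 2 powr (n * binary_entropy \<delta>)"
  using card_hamming_ball_le_binomial[OF assms(1), of "\<delta> * n"] binomial_tail_le_entropy[OF assms(2,3), of n]
  by linarith

section \<open>The random sparse construction as sequential sampling\<close>

definition pool :: "nat \<Rightarrow> real \<Rightarrow> bool list list \<Rightarrow> bool list set" where
  "pool n r h = words n - (\<Union>w\<in>set h. hamming_ball n r w)"

primrec blocks :: "nat \<Rightarrow> 's list \<Rightarrow> 'a list \<Rightarrow> 's \<Rightarrow> 'a set" where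
  "blocks t [] xs = (\<lambda>_. {})"
| "blocks t (s # ss) xs = (blocks t ss (drop t xs))(s := set (take t xs))"

text \<open>The remaining pool is a function of the history, so the two components carried by the
  construction can be read off from the list of all draws. The accumulator \<open>A\<close> is
  general for the induction.\<close>

lemma draw_codewords_conv_draws:
  "draw_codewords n \<delta> t (pool n (\<delta> * n) h) A
   = map_spmf (\<lambda>h'. (pool n (\<delta> * n) h', A \<union> set (drop (length h) h'))) (draws (pool n (\<delta> * n)) t h)"
proof (induction t arbitrary: h A)
  case (Suc t)
  let ?G = "pool n (\<delta> * n)"
  have P: "?G h - hamming_ball n (\<delta> * n) w = ?G (h @ [w])" for w
    by (auto simp: pool_def)
  have "map_spmf (\<lambda>h'. (?G h', insert w A \<union> set (drop (length (h @ [w])) h'))) (draws ?G t (h @ [w]))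
     = map_spmf (\<lambda>h'. (?G h', A \<union> set (drop (length h) h'))) (draws ?G t (h @ [w]))" for w
  proof (rule map_spmf_cong[OF refl])
    fix h' assume h': "h' \<in> set_spmf (draws ?G t (h @ [w]))"
    from draws_support(2)[OF h'] obtain ys where "h' = (h @ [w]) @ ys"
      by (metis append_take_drop_id)
    then show "(?G h', insert w A \<union> set (drop (length (h @ [w])) h')) = (?G h', A \<union> set (drop (length h) h'))"
      by simp
  qed
  then show ?case
    by (simp add: P Suc.IH map_spmf_bind_spmf o_def)
qed simp

lemma draw_code_conv_draws:
  "draw_code n \<delta> t ss (pool n (\<delta> * n) h)
   = map_spmf (\<lambda>h'. blocks t ss (drop (length h) h')) (draws (pool n (\<delta> * n)) (t * length ss) h)"
proof (induction ss arbitrary: h)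
  case Nil
  then show ?case by simp
next
  case (Cons s ss)
  let ?G = "pool n (\<delta> * n)"
  have "draw_code n \<delta> t (s # ss) (?G h)
     = bind_spmf (draws ?G t h) (\<lambda>h'. map_spmf (\<lambda>h''. (blocks t ss (drop (length h') h''))(s := set (drop (length h) h')))
         (draws ?G (t * length ss) h'))"
    by (simp add: draw_codewords_conv_draws bind_map_spmf o_def Cons.IH spmf.map_comp)
  also have "\<dots> = bind_spmf (draws ?G t h) (\<lambda>h'. map_spmf (\<lambda>h''. blocks t (s # ss) (drop (length h) h''))
         (draws ?G (t * length ss) h'))"
  proof (intro bind_spmf_cong[OF refl] map_spmf_cong[OF refl])
    fix h' h'' assume h': "h' \<in> set_spmf (draws ?G t h)" and h'': "h'' \<in> set_spmf (draws ?G (t * length ss) h')"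
    have l: "length h' = length h + t" "take (length h') h'' = h'"
      using draws_support[OF h'] draws_support[OF h''] by auto
    have "take t (drop (length h) h'') = drop (length h) (take (length h + t) h'')"
      by (simp add: take_drop add.commute)
    then show "(blocks t ss (drop (length h') h''))(s := set (drop (length h) h'))
        = blocks t (s # ss) (drop (length h) h'')"
      using l by (simp add: add.commute)
  qed
  also have "\<dots> = map_spmf (\<lambda>h''. blocks t (s # ss) (drop (length h) h'')) (draws ?G (t * length (s # ss)) h)"
    by (simp add: draws_add map_spmf_bind_spmf o_def)
  finally show ?case .
qed

lemma sparse_construction_conv_draws:
  "sparse_construction n \<delta> t ss = map_spmf (blocks t ss) (draws (pool n (\<delta> * n)) (t * length ss) [])"
  using draw_code_conv_draws[of n \<delta> t ss "[]"] by (simp add: sparse_construction_def pool_def)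

text \<open>The uniqueness test in \<open>sparse_dec\<close> ranges over all lists and not only over
  messages, so the sets outside the message list must be known to be empty.\<close>

lemma blocks_notin: "s \<notin> set ss \<Longrightarrow> blocks t ss xs s = {}"
  by (induction ss arbitrary: xs) auto

lemma blocks_nth:
  assumes "distinct ss" "b < length ss" "length xs = t * length ss"
  shows "blocks t ss xs (ss ! b) = (!) xs ` {b * t..<b * t + t}"
  using assms
proof (induction ss arbitrary: xs b)
  case (Cons s ss)
  show ?case
  proof (cases b)
    case 0
    then show ?thesis using Cons.prems
      by (auto simp: set_conv_nth image_def) (metis nth_take)+
  next
    case (Suc c)
    have "ss ! c \<noteq> s" using Cons.prems Suc by auto
    then have "blocks t (s # ss) xs ((s # ss) ! b) = blocks t ss (drop t xs) (ss ! c)"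
      using Suc by simp
    also have "\<dots> = (!) (drop t xs) ` {c * t..<c * t + t}"
      using Cons.prems Suc by (intro Cons.IH) auto
    also have "\<dots> = (\<lambda>i. xs ! (t + i)) ` {c * t..<c * t + t}"
      using Cons.prems by (intro image_cong) auto
    also have "\<dots> = (!) xs ` ((+) t ` {c * t..<c * t + t})"
      by (simp only: image_image)
    also have "(+) t ` {c * t..<c * t + t} = {b * t..<b * t + t}"
      using Suc by (simp add: ac_simps)
    finally show ?thesis .
  qed
qed simp

section \<open>Codes with separated codewords\<close>

text \<open>Upper bounds suffice, because the upper bound for the complement of an event is a lower
  bound for the event. Of the reference \<open>\<mu>\<close> only its behaviour under complements
  matters, so it can be a normalised count.\<close>

lemma tv_dist_le:
  assumes p: "\<And>A. measure_pmf.prob p A \<le> \<mu> A + \<epsilon> / 2"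
    and q: "\<And>A. measure_pmf.prob q A \<le> \<mu> A + \<epsilon> / 2"
    and \<mu>: "\<And>A. \<mu> A + \<mu> (- A) = 1"
  shows "tv_dist p q \<le> \<epsilon>"
  unfolding tv_dist_def
proof (rule cSUP_least)
  fix A
  have "measure_pmf.prob p (- A) = 1 - measure_pmf.prob p A"
    "measure_pmf.prob q (- A) = 1 - measure_pmf.prob q A"
    using measure_pmf.prob_compl[of A p] measure_pmf.prob_compl[of A q]
    by (simp_all add: Compl_eq_Diff_UNIV)
  then show "\<bar>measure_pmf.prob p A - measure_pmf.prob q A\<bar> \<le> \<epsilon>"
    using p[of A] p[of "- A"] q[of A] q[of "- A"] \<mu>[of A] by linarith
qed simp

lemma tv_dist_le_1: "tv_dist p q \<le> 1"
  unfolding tv_dist_def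
proof (rule cSUP_least)
  fix A
  show "\<bar>measure_pmf.prob p A - measure_pmf.prob q A\<bar> \<le> 1"
    using measure_pmf.prob_le_1[of p A] measure_pmf.prob_le_1[of q A]
      measure_nonneg[of p A] measure_nonneg[of q A] by linarith
qed simp

text \<open>What every completed run guarantees with certainty. A pool excludes the balls around
  earlier words, hence \<open>sep\<close> speaks only of \<open>i < j\<close>; symmetry of the
  distance gives the rest.\<close>

locale packed_code =
  fixes n k t :: nat and \<delta> :: real and ss :: "bool list list" and xs :: "bool list list"
  assumes k_le: "k \<le> n" and t_pos: "0 < t" and \<delta>_nonneg: "0 \<le> \<delta>"
    and order: "message_order k ss" and len: "length xs = t * length ss"
    and in_words: "set xs \<subseteq> words n"
    and sep: "\<And>i j. i < j \<Longrightarrow> j < length xs \<Longrightarrow> xs ! j \<notin> hamming_ball n (\<delta> * n) (xs ! i)"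
begin

abbreviation E where "E \<equiv> blocks t ss xs"

lemma nth_in_words: "i < length xs \<Longrightarrow> xs ! i \<in> words n"
  using in_words by auto

lemma separated:
  assumes "v \<in> set xs" "w \<in> set xs" "v \<noteq> w"
  shows "v \<notin> hamming_ball n (\<delta> * n) w"
proof -
  obtain i j where ij: "i < length xs" "j < length xs" "v = xs ! i" "w = xs ! j"
    using assms by (auto simp: in_set_conv_nth)
  then have "i \<noteq> j" using assms by auto
  then show ?thesis
    using ij sep[of i j] sep[of j i] hamming_ball_commute[OF nth_in_words nth_in_words]
    by (metis linorder_neqE_nat)
qed

lemma distinct_xs: "distinct xs"
proof -
  have "xs ! i \<noteq> xs ! j" if "i < j" "j < length xs" for i j
    using sep[OF that] nth_in_words[of j] center_in_hamming_ball[of "xs ! j" n "\<delta> * n"] that \<delta>_nonneg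
    by auto
  then show ?thesis by (metis distinct_conv_nth linorder_neqE_nat)
qed

lemma block_of:
  assumes "s \<in> words k"
  obtains b where "b < length ss" "s = ss ! b"
  using assms order by (metis in_set_conv_nth message_order_def)

lemma E_nth: "b < length ss \<Longrightarrow> E (ss ! b) = (!) xs ` {b * t..<b * t + t}"
  using blocks_nth[OF _ _ len] order by (simp add: message_order_def)

lemma block_index_less: "b < length ss \<Longrightarrow> i < b * t + t \<Longrightarrow> i < length xs"
proof -
  assume b: "b < length ss" and i: "i < b * t + t"
  have "b * t + t \<le> length ss * t"
    using b by (metis Suc_leI add.commute mult_Suc mult_le_mono1)
  then show ?thesis using i len by (simp add: mult.commute)
qed

lemma inj_on_block: "b < length ss \<Longrightarrow> inj_on ((!) xs) {b * t..<b * t + t}"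
  using distinct_xs block_index_less by (intro inj_on_nth) auto

lemma E_subset: "E s \<subseteq> set xs"
  by (cases "s \<in> words k")
    (use E_nth block_index_less order in \<open>fastforce elim: block_of simp: blocks_notin message_order_def\<close>)+

lemma card_E: "s \<in> words k \<Longrightarrow> card (E s) = t"
  by (erule block_of) (simp add: E_nth card_image[OF inj_on_block])

lemma finite_E: "finite (E s)"
  using E_subset finite_subset by blast

lemma E_ne: "s \<in> words k \<Longrightarrow> E s \<noteq> {}"
  using card_E t_pos by fastforce

text \<open>The draws are distinct, so a codeword has a unique index, and dividing that index by
  \<open>t\<close> recovers its block.\<close>

lemma E_disjoint:
  assumes "w \<in> E s" "w \<in> E s'"
  shows "s = s'"
proof -
  have sw: "s \<in> words k" "s' \<in> words k"
    using assms blocks_notin order by (metis empty_iff message_order_def)+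
  obtain b where b: "b < length ss" "s = ss ! b" using block_of[OF sw(1)] .
  obtain c where c: "c < length ss" "s' = ss ! c" using block_of[OF sw(2)] .
  obtain i where i: "i \<in> {b * t..<b * t + t}" "w = xs ! i"
    using assms b by (auto simp: E_nth)
  obtain j where j: "j \<in> {c * t..<c * t + t}" "w = xs ! j"
    using assms c by (auto simp: E_nth)
  have "i = j"
    using i j b c block_index_less distinct_xs by (metis atLeastLessThan_iff nth_eq_iff_index_eq)
  moreover have "i div t = b" using i t_pos by (intro div_nat_eqI) (auto simp: algebra_simps)
  moreover have "j div t = c" using j t_pos by (intro div_nat_eqI) (auto simp: algebra_simps)
  ultimately show ?thesis using b c by simp
qed

lemma dec_E: "w \<in> E s \<Longrightarrow> sparse_dec E w = Some s"
  using E_disjoint unfolding sparse_dec_def by (auto intro!: the_equality)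

lemma dec_None: "w \<notin> set xs \<Longrightarrow> sparse_dec E w = None"
  using E_subset unfolding sparse_dec_def by auto

lemma dec_SomeD: "sparse_dec E w = Some s \<Longrightarrow> w \<in> E s"
  unfolding sparse_dec_def by (metis option.distinct(1) option.inject theI')

lemma coding_scheme_E: "coding_scheme n k (sparse_enc E) (sparse_dec E)"
  unfolding coding_scheme_def
proof (intro conjI ballI)
  fix s assume s: "s \<in> words k"
  show "set_pmf (sparse_enc E s) \<subseteq> words n"
    using E_subset in_words s by (auto simp: sparse_enc_def finite_E E_ne)
  show "measure_pmf.prob (sparse_enc E s) {w. sparse_dec E w = Some s} = 1"
    using s by (subst measure_pmf.prob_eq_1)
      (auto simp: sparse_enc_def AE_measure_pmf_iff finite_E E_ne dec_E)
next
  fix w assume "w \<in> words n"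
  have "s \<in> words k" if "w \<in> E s" for s
    using that blocks_notin order by (metis empty_iff message_order_def)
  then show "sparse_dec E w \<in> insert None (Some ` words k)"
    using dec_SomeD by (cases "sparse_dec E w") auto
qed (rule k_le)

text \<open>A codeword shifted by a nonzero vector of small weight lies in the ball around that
  codeword but differs from it, so separation keeps it out of the code.\<close>

lemma has_relative_distance_E: "has_relative_distance n k \<delta> (sparse_enc E) (sparse_dec E)"
  unfolding has_relative_distance_def
proof (intro ballI impI)
  fix s \<Delta> assume s: "s \<in> words k" and \<Delta>: "\<Delta> \<in> words n"
    and w: "\<Delta> \<noteq> replicate n False \<and> real (weight \<Delta>) \<le> \<delta> * real n"
  have "w \<oplus>\<^sub>2 \<Delta> \<notin> set xs" if "w \<in> E s" for w
  proof
    assume v: "w \<oplus>\<^sub>2 \<Delta> \<in> set xs"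
    have wx: "w \<in> set xs" "length w = n" using that E_subset in_words by (auto simp: words_def)
    have \<Delta>': "(w \<oplus>\<^sub>2 \<Delta>) \<oplus>\<^sub>2 w = \<Delta>" using wx \<Delta> by (simp add: xor_word_cancel words_def)
    have "w \<oplus>\<^sub>2 w = replicate n False"
      using wx by (intro nth_equalityI) (auto simp: nth_xor_word)
    then have "w \<oplus>\<^sub>2 \<Delta> \<noteq> w" using \<Delta>' w by auto
    from separated[OF v wx(1) this] show False
      using \<Delta>' w wx \<Delta> by (simp add: hamming_ball_def words_def)
  qed
  then show "measure_pmf.prob (sparse_enc E s) {w. sparse_dec E (w \<oplus>\<^sub>2 \<Delta>) = None} = 1"
    using s by (subst measure_pmf.prob_eq_1)
      (auto simp: sparse_enc_def AE_measure_pmf_iff finite_E E_ne dec_None)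
qed

text \<open>Indices of a block correspond bijectively to codewords of its message, which reduces all
  later probabilities over the encoder to counting indices.\<close>

lemma prob_tamper_dist:
  assumes b: "b < length ss"
  shows "measure_pmf.prob (tamper_dist (sparse_enc E) (sparse_dec E) f (ss ! b)) A
    = card {i \<in> {b * t..<b * t + t}.
        (if f (xs ! i) = xs ! i then Same else Decoded (sparse_dec E (f (xs ! i)))) \<in> A} / t"
proof -
  let ?s = "ss ! b"
  let ?res = "\<lambda>w. if f w = w then Same else Decoded (sparse_dec E (f w))"
  have s: "?s \<in> words k" using b order nth_mem[of b ss] by (simp add: message_order_def)
  have "measure_pmf.prob (tamper_dist (sparse_enc E) (sparse_dec E) f ?s) A
     = card (E ?s \<inter> ?res -` A) / t"
    unfolding tamper_dist_def sparse_enc_def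
    by (simp add: measure_pmf_of_set[OF E_ne[OF s] finite_E] card_E[OF s])
  also have "E ?s \<inter> ?res -` A = (!) xs ` {i \<in> {b * t..<b * t + t}. ?res (xs ! i) \<in> A}"
    unfolding E_nth[OF b] by auto
  also have "card \<dots> = card {i \<in> {b * t..<b * t + t}. ?res (xs ! i) \<in> A}"
    by (intro card_image inj_on_subset[OF inj_on_block[OF b]]) auto
  finally show ?thesis .
qed

end

section \<open>Light collisions\<close>

lemma sum_card_fibers:
  assumes "finite A" "finite B"
  shows "(\<Sum>y\<in>B. card {a \<in> A. g a = y}) = card {a \<in> A. g a \<in> B}"
proof -
  have "card (\<Union>y\<in>B. {a \<in> A. g a = y}) = (\<Sum>y\<in>B. card {a \<in> A. g a = y})"
    using assms by (intro card_UN_disjoint) auto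
  moreover have "(\<Union>y\<in>B. {a \<in> A. g a = y}) = {a \<in> A. g a \<in> B}" by auto
  ultimately show ?thesis by simp
qed

text \<open>The number of predecessors is injective on \<open>J\<close>, and here it takes values
  below \<open>K\<close>.\<close>

lemma card_few_predecessors_le:
  fixes J :: "nat set"
  assumes "finite J"
  shows "card {i \<in> J. card {j \<in> J. j < i} < K} \<le> K"
proof -
  let ?r = "\<lambda>i. card {j \<in> J. j < i}"
  have less: "?r i < ?r i'" if "i \<in> J" "i < i'" for i i'
    using that assms by (intro psubset_card_mono) auto
  have "inj_on ?r {i \<in> J. ?r i < K}"
    by (rule linorder_inj_onI) (use less in fastforce)+
  moreover have "?r ` {i \<in> J. ?r i < K} \<subseteq> {..<K}" by auto
  ultimately show ?thesis using card_inj_on_le[of ?r _ "{..<K}"] by simp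
qed

definition hits :: "nat set \<Rightarrow> 'a set \<Rightarrow> ('a \<Rightarrow> 'a) \<Rightarrow> 'a list \<Rightarrow> 'a \<Rightarrow> nat set" where
  "hits I R f h y = {i \<in> I. i < length h \<and> h ! i \<in> R \<and> f (h ! i) = y}"

text \<open>The first \<open>K\<close> hits of \<open>y\<close>. The cap bounds what one later draw
  of \<open>y\<close> can contribute, so that division by \<open>K\<close> gives a statistic in
  [0,1].\<close>

definition early_hits :: "nat \<Rightarrow> nat set \<Rightarrow> 'a set \<Rightarrow> ('a \<Rightarrow> 'a) \<Rightarrow> 'a list \<Rightarrow> 'a \<Rightarrow> nat set" where
  "early_hits K I R f h y =
     {i \<in> hits I R f h y. card {j \<in> hits I R f h y. j < i} < K}"

lemma finite_hits: "finite I \<Longrightarrow> finite (hits I R f h y)"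
  by (simp add: hits_def)

text \<open>The hits preceding index \<open>i\<close> are settled once \<open>i\<close> words are
  drawn; extending the history does not change them.\<close>

lemma hits_take:
  "i \<le> j \<Longrightarrow> j \<le> length X \<Longrightarrow> {l \<in> hits I R f (take j X) y. l < i} = hits I R f (take i X) y"
  by (auto simp: hits_def)

lemma sum_card_hits_le:
  assumes "finite I" "finite Y"
  shows "(\<Sum>y\<in>Y. card (hits I R f h y)) \<le> card I"
proof -
  let ?A = "{i \<in> I. i < length h \<and> h ! i \<in> R}"
  have "(\<Sum>y\<in>Y. card (hits I R f h y)) = (\<Sum>y\<in>Y. card {i \<in> ?A. f (h ! i) = y})"
    unfolding hits_def by (intro sum.cong arg_cong[of _ _ card]) auto
  also have "\<dots> = card {i \<in> ?A. f (h ! i) \<in> Y}"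
    using assms by (intro sum_card_fibers) auto
  also have "\<dots> \<le> card I" using assms by (intro card_mono) auto
  finally show ?thesis .
qed

section \<open>Tail bounds for a fixed block of indices\<close>

context sequential_sampling
begin

lemma measure_draws_mono:
  assumes "\<And>xs. xs \<in> set_spmf (draws G T []) \<Longrightarrow> length xs = T \<Longrightarrow> set xs \<subseteq> U \<Longrightarrow> xs \<in> A \<Longrightarrow> xs \<in> B"
  shows "measure (measure_spmf (draws G T [])) A \<le> measure (measure_spmf (draws G T [])) B"
  using assms draws_support(1)[of _ G T "[]"] draws_in_U
  by (intro measure_spmf.finite_measure_mono_AE) (auto simp: AE_measure_spmf_iff)

text \<open>The slack is additive, so \<open>\<theta>\<close> has to be of order
  \<open>\<epsilon>\<close>: the second-order term of the exponential moment and the loss through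
  the pool must stay below it.\<close>

lemma block_count_tail:
  fixes \<epsilon> :: real
  assumes I: "I \<subseteq> {..<T}" and S: "S \<subseteq> U" and \<epsilon>: "0 < \<epsilon>" "\<epsilon> \<le> 1" and \<kappa>\<epsilon>: "\<kappa> \<le> \<epsilon> / 64"
  shows "measure (measure_spmf (draws G T []))
      {xs. card I * (card S / card U + \<epsilon> / 8) \<le> card {i \<in> I. xs ! i \<in> S}}
    \<le> exp (- (\<epsilon>\<^sup>2 * card I / 1024))"
proof -
  have finI: "finite I" using I finite_subset by blast
  define z :: "'a list \<Rightarrow> 'a \<Rightarrow> real" where "z h x = of_bool (length h \<in> I \<and> x \<in> S)" for h x
  define p where "p = card S / card U"
  define \<nu> :: "nat \<Rightarrow> real" where "\<nu> i = of_bool (i \<in> I) * p" for i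
  \<comment> \<open>With this choice and \<kappa> \<le> \<epsilon> / 64 the relative loss is at most
    \<theta> + 4 \<kappa> \<le> 3 \<epsilon> / 32, which leaves \<epsilon> / 32 of the slack
    \<epsilon> / 8; the exponent is \<theta> times this remainder.\<close>
  define \<theta> where "\<theta> = \<epsilon> / 32"
  define a where "a = card I * (p + \<epsilon> / 8)"
  have cU: "0 < real (card U)" using card_U_pos by simp
  have p: "0 \<le> p" "p \<le> 1" using cU card_mono[OF finite_U S] by (auto simp: p_def divide_simps)
  have sum\<nu>: "(\<Sum>i<T. \<nu> i) = card I * p"
  proof -
    have "(\<Sum>i<T. \<nu> i) = (\<Sum>i\<in>{..<T} \<inter> I. p)"
      unfolding \<nu>_def by (intro sum.mono_neutral_cong_right) auto
    then show ?thesis using I by (simp add: Int_absorb1)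
  qed
  have "measure (measure_spmf (draws G T [])) {xs. a \<le> card {i \<in> I. xs ! i \<in> S}}
    \<le> measure (measure_spmf (draws G T [])) {xs. a \<le> (\<Sum>i<T. z (take i xs) (xs ! i))}"
  proof (rule measure_draws_mono)
    fix xs :: "'a list" assume len: "length xs = T" and "xs \<in> {xs. a \<le> card {i \<in> I. xs ! i \<in> S}}"
    moreover have "(\<Sum>i<T. z (take i xs) (xs ! i)) = card {i \<in> I. xs ! i \<in> S}"
    proof -
      have "(\<Sum>i<T. z (take i xs) (xs ! i)) = (\<Sum>i\<in>{i \<in> I. xs ! i \<in> S}. 1)"
        unfolding z_def using I len by (intro sum.mono_neutral_cong_right) auto
      then show ?thesis by simp
    qed
    ultimately show "xs \<in> {xs. a \<le> (\<Sum>i<T. z (take i xs) (xs ! i))}" by simp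
  qed
  also have "\<dots> \<le> exp (- (\<epsilon>\<^sup>2 * card I / 1024))"
  proof (rule chernoff[where z = z and \<nu> = \<nu> and \<theta> = \<theta>])
    fix h :: "'a list"
    have "(\<Sum>x\<in>U. z h x) = of_bool (length h \<in> I) * card S"
    proof -
      have "(\<Sum>x\<in>U. z h x) = (\<Sum>x\<in>S. of_bool (length h \<in> I))"
        unfolding z_def using S finite_U by (intro sum.mono_neutral_cong_right) auto
      then show ?thesis by simp
    qed
    then show "(\<Sum>x\<in>U. z h x) \<le> \<nu> (length h) * card U"
      using cU by (simp add: \<nu>_def p_def)
  next
    have k1: "1 / (1 - \<kappa>) \<le> 1 + 2 * \<kappa>"
    proof -
      have "0 \<le> \<kappa> * (1 - 2 * \<kappa>)" using \<kappa>_nonneg \<kappa>_le by simp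
      then have "1 \<le> (1 + 2 * \<kappa>) * (1 - \<kappa>)" by (simp add: algebra_simps)
      then show ?thesis using \<kappa>_le by (simp add: pos_divide_le_eq)
    qed
    have \<theta>: "0 < \<theta>" "\<theta> \<le> 1" using \<epsilon> by (auto simp: \<theta>_def)
    have "(\<theta> + \<theta>\<^sup>2) / (1 - \<kappa>) = (\<theta> + \<theta>\<^sup>2) * (1 / (1 - \<kappa>))" by simp
    also have "\<dots> \<le> (\<theta> + \<theta>\<^sup>2) * (1 + 2 * \<kappa>)" using k1 \<theta> by (intro mult_left_mono) auto
    also have "\<dots> = \<theta> + \<theta> * (\<theta> + 2 * \<kappa> + \<theta> * (2 * \<kappa>))" by (simp add: algebra_simps power2_eq_square)
    also have "\<dots> \<le> \<theta> + \<theta> * (\<theta> + 2 * \<kappa> + 1 * (2 * \<kappa>))"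
      using \<theta> \<kappa>_nonneg by (intro add_left_mono mult_left_mono mult_right_mono) auto
    also have "\<dots> \<le> \<theta> + \<theta> * (3 * \<epsilon> / 32)"
      using \<theta> \<kappa>\<epsilon> by (intro add_left_mono mult_left_mono) (auto simp: \<theta>_def)
    finally have c: "(\<theta> + \<theta>\<^sup>2) / (1 - \<kappa>) \<le> \<theta> + \<theta> * (3 * \<epsilon> / 32)" .
    have "(\<theta> + \<theta>\<^sup>2) / (1 - \<kappa>) * (card I * p) - \<theta> * a
      \<le> (\<theta> + \<theta> * (3 * \<epsilon> / 32)) * (card I * p) - \<theta> * a"
      using c p by (intro diff_right_mono mult_right_mono) auto
    also have "\<dots> = \<theta> * card I * (3 * \<epsilon> / 32 * p - \<epsilon> / 8)"
      by (simp add: a_def algebra_simps)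
    also have "\<dots> \<le> \<theta> * card I * (3 * \<epsilon> / 32 * 1 - \<epsilon> / 8)"
      using p \<theta> \<epsilon> by (intro mult_left_mono diff_right_mono) auto
    also have "\<dots> = - (\<epsilon>\<^sup>2 * card I / 1024)"
      by (simp add: \<theta>_def power2_eq_square)
    finally show "(\<theta> + \<theta>\<^sup>2) / (1 - \<kappa>) * (\<Sum>i<T. \<nu> i) - \<theta> * a \<le> - (\<epsilon>\<^sup>2 * card I / 1024)"
      by (simp add: sum\<nu>)
  qed (use \<epsilon> in \<open>auto simp: z_def \<theta>_def\<close>)
  finally show ?thesis by (simp add: a_def p_def)
qed

text \<open>A new codeword enlarges the preimage of the code by one fibre. Fibres of
  \<open>R\<close> have at most N / r points by lightness, where N is the size of \<open>U\<close>,
  and one point on average over all values. Scaled by r / N, the expected total is of order r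
  \<epsilon> / 512, while the threshold is r \<epsilon> / 64.\<close>

lemma preimage_mass_tail:
  fixes r \<epsilon> :: real
  assumes R: "R \<subseteq> U" and light: "\<And>y. card {u \<in> R. f u = y} * r \<le> card U"
    and r: "0 < (r::real)" and T: "T \<le> \<epsilon> / 512 * card U" and \<epsilon>: "0 < \<epsilon>"
  shows "measure (measure_spmf (draws G T []))
      {xs. \<epsilon> / 64 * card U \<le> card {u \<in> R. f u \<in> set xs}} \<le> exp (- (r * \<epsilon> / 128))"
proof -
  define N where "N = real (card U)"
  have N: "0 < N" using card_U_pos by (simp add: N_def)
  have finR: "finite R" using R finite_U finite_subset by blast
  define z :: "'a list \<Rightarrow> 'a \<Rightarrow> real" where "z h x = card {u \<in> R. f u = x} * (r / N)" for h x
  have "measure (measure_spmf (draws G T [])) {xs. \<epsilon> / 64 * card U \<le> card {u \<in> R. f u \<in> set xs}}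
    \<le> measure (measure_spmf (draws G T [])) {xs. r * \<epsilon> / 64 \<le> (\<Sum>i<T. z (take i xs) (xs ! i))}"
  proof (rule measure_draws_mono)
    fix xs :: "'a list" assume len: "length xs = T"
      and xs: "xs \<in> {xs. \<epsilon> / 64 * card U \<le> card {u \<in> R. f u \<in> set xs}}"
    have "{u \<in> R. f u \<in> set xs} = (\<Union>i<T. {u \<in> R. f u = xs ! i})"
      using len by (auto simp: in_set_conv_nth)
    then have "card {u \<in> R. f u \<in> set xs} \<le> (\<Sum>i<T. card {u \<in> R. f u = xs ! i})"
      using card_UN_le[of "{..<T}"] by simp
    then have "\<epsilon> / 64 * N \<le> (\<Sum>i<T. real (card {u \<in> R. f u = xs ! i}))"
      using xs unfolding N_def mem_Collect_eq of_nat_sum[symmetric] by linarith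
    then have "\<epsilon> / 64 * N * (r / N) \<le> (\<Sum>i<T. real (card {u \<in> R. f u = xs ! i})) * (r / N)"
      using r N by (intro mult_right_mono) auto
    then show "xs \<in> {xs. r * \<epsilon> / 64 \<le> (\<Sum>i<T. z (take i xs) (xs ! i))}"
      using N by (simp only: z_def sum_distrib_right mem_Collect_eq) (simp add: mult.commute)
  qed
  also have "\<dots> \<le> exp (- (r * \<epsilon> / 128))"
  proof (rule chernoff_unit[where z = z and \<nu> = "\<lambda>_. r / N"])
    fix h :: "'a list" and x
    show "0 \<le> z h x \<and> z h x \<le> 1" using r N light[of x] by (simp add: z_def N_def)
    have "(\<Sum>x\<in>U. card {u \<in> R. f u = x}) \<le> card R"
      unfolding sum_card_fibers[OF finR finite_U] using finR by (intro card_mono) auto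
    also have "\<dots> \<le> card U" using R finite_U by (intro card_mono)
    finally have "real (\<Sum>x\<in>U. card {u \<in> R. f u = x}) * (r / N) \<le> N * (r / N)"
      using r N by (intro mult_right_mono) (simp_all only: N_def of_nat_le_iff, simp)
    then show "(\<Sum>x\<in>U. z h x) \<le> r / N * card U"
      using N by (simp only: z_def sum_distrib_right of_nat_sum) (simp add: N_def)
  next
    have "4 * (T * (r / N)) \<le> 4 * (\<epsilon> / 512 * N * (r / N))"
      using T r N by (intro mult_left_mono mult_right_mono) (auto simp: N_def)
    also have "\<dots> = r * \<epsilon> / 128" using N by simp
    finally show "4 * (\<Sum>i<T. r / N) - r * \<epsilon> / 64 \<le> - (r * \<epsilon> / 128)"
      by (simp only: sum_constant card_lessThan)
  qed (use r N in auto)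
  finally show ?thesis .
qed

text \<open>A new word is charged if it is sent to an earlier word, or to a value that already has
  \<open>K\<close> hits. The bound on the preimage mass is part of the event, because the Chernoff
  bound asks for a small conditional mean at every history, including those where the mass has grown
  too large.\<close>

definition risky ::
    "nat \<Rightarrow> nat set \<Rightarrow> 'a set \<Rightarrow> ('a \<Rightarrow> 'a) \<Rightarrow> real \<Rightarrow> 'a list \<Rightarrow> 'a \<Rightarrow> bool" where
  "risky K I R f \<epsilon> h x \<longleftrightarrow> length h \<in> I \<and> x \<in> R \<and>
     (f x \<in> set h \<and> card {u \<in> R. f u \<in> set h} < \<epsilon> / 64 * card U \<or> K \<le> card (hits I R f h (f x)))"

lemma risky_tail:
  fixes r \<epsilon> :: real
  assumes R: "R \<subseteq> U" and light: "\<And>y. card {u \<in> R. f u = y} * r \<le> card U"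
    and r: "0 < (r::real)" and \<epsilon>: "0 < \<epsilon>" and I: "I \<subseteq> {..<T}"
    and K: "64 * card I \<le> r * \<epsilon> * real K" "0 < K"
  shows "measure (measure_spmf (draws G T []))
      {xs. \<epsilon> / 4 * card I \<le> card {i \<in> I. risky K I R f \<epsilon> (take i xs) (xs ! i)}} \<le> exp (- (\<epsilon> * card I / 8))"
proof -
  have finI: "finite I" using I finite_subset by blast
  have finR: "finite R" using R finite_U finite_subset by blast
  define N where "N = real (card U)"
  have N: "0 < N" using card_U_pos by (simp add: N_def)
  define z :: "'a list \<Rightarrow> 'a \<Rightarrow> real" where "z h x = of_bool (risky K I R f \<epsilon> h x)" for h x
  define \<nu> :: "nat \<Rightarrow> real" where "\<nu> i = of_bool (i \<in> I) * (\<epsilon> / 32)" for i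
  \<comment> \<open>At most card I / K values can have \<open>K\<close> hits, and each has at most N
    / r preimages in \<open>R\<close>; assumption \<open>K\<close> is exactly what makes the product
    small.\<close>
  have overfull: "card {x \<in> R. K \<le> card (hits I R f h (f x))} \<le> \<epsilon> / 64 * N" for h
  proof -
    define Y where "Y = {y \<in> f ` R. K \<le> card (hits I R f h y)}"
    have finY: "finite Y" using finR by (simp add: Y_def)
    have "card Y * K \<le> (\<Sum>y\<in>Y. card (hits I R f h y))"
      using sum_bounded_below[of Y K "\<lambda>y. card (hits I R f h y)"] by (simp add: Y_def)
    also have "\<dots> \<le> card I" by (rule sum_card_hits_le[OF finI finY])
    finally have YK: "real (card Y) * K \<le> card I"
      unfolding of_nat_mult[symmetric] by (rule of_nat_mono)
    have "{x \<in> R. K \<le> card (hits I R f h (f x))} = {x \<in> R. f x \<in> Y}" by (auto simp: Y_def)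
    then have "real (card {x \<in> R. K \<le> card (hits I R f h (f x))}) = (\<Sum>y\<in>Y. real (card {x \<in> R. f x = y}))"
      by (simp only: sum_card_fibers[OF finR finY, of f, symmetric] of_nat_sum)
    also have "\<dots> \<le> (\<Sum>y\<in>Y. N / r)"
      using light r by (intro sum_mono) (simp add: N_def pos_le_divide_eq)
    also have "\<dots> = card Y * (N / r)" by simp
    also have "\<dots> \<le> \<epsilon> / 64 * N"
    proof -
      have "64 * (real (card Y) * K) \<le> r * \<epsilon> * K" using YK K by linarith
      then have "64 * real (card Y) \<le> r * \<epsilon>" using K by simp
      then have "card Y \<le> \<epsilon> / 64 * r" by (simp add: mult.commute)
      then have "card Y * (N / r) \<le> \<epsilon> / 64 * r * (N / r)" using N r by (intro mult_right_mono) auto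
      then show ?thesis using r by simp
    qed
    finally show ?thesis .
  qed
  have "measure (measure_spmf (draws G T []))
      {xs. \<epsilon> / 4 * card I \<le> card {i \<in> I. risky K I R f \<epsilon> (take i xs) (xs ! i)}}
    \<le> measure (measure_spmf (draws G T [])) {xs. \<epsilon> / 4 * card I \<le> (\<Sum>i<T. z (take i xs) (xs ! i))}"
  proof (rule measure_draws_mono)
    fix xs :: "'a list"
    assume xs: "xs \<in> {xs. \<epsilon> / 4 * card I \<le> card {i \<in> I. risky K I R f \<epsilon> (take i xs) (xs ! i)}}"
      and len: "length xs = T"
    have "(\<Sum>i<T. z (take i xs) (xs ! i)) = (\<Sum>i\<in>{i \<in> I. risky K I R f \<epsilon> (take i xs) (xs ! i)}. 1)"
      unfolding z_def using I len
      by (intro sum.mono_neutral_cong_right) (auto simp: risky_def min_absorb2 less_imp_le)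
    then show "xs \<in> {xs. \<epsilon> / 4 * card I \<le> (\<Sum>i<T. z (take i xs) (xs ! i))}" using xs by simp
  qed
  also have "\<dots> \<le> exp (- (\<epsilon> * card I / 8))"
  proof (rule chernoff_unit[where z = z and \<nu> = \<nu>])
    fix h :: "'a list"
    have "(\<Sum>x\<in>U. z h x) = card {x \<in> U. risky K I R f \<epsilon> h x}"
      unfolding z_def using finite_U by (simp add: Int_def)
    also have "\<dots> \<le> of_bool (length h \<in> I) * (\<epsilon> / 32 * N)"
    proof (cases "length h \<in> I")
      case True
      let ?A = "{x \<in> R. f x \<in> set h \<and> card {u \<in> R. f u \<in> set h} < \<epsilon> / 64 * card U}"
      let ?B = "{x \<in> R. K \<le> card (hits I R f h (f x))}"
      have "card {x \<in> U. risky K I R f \<epsilon> h x} \<le> card (?A \<union> ?B)"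
        using finR by (intro card_mono) (auto simp: risky_def)
      also have "\<dots> \<le> card ?A + card ?B" by (rule card_Un_le)
      finally have "real (card {x \<in> U. risky K I R f \<epsilon> h x}) \<le> card ?A + card ?B" by simp
      moreover have "card ?A \<le> \<epsilon> / 64 * N"
        using N \<epsilon> by (cases "card {u \<in> R. f u \<in> set h} < \<epsilon> / 64 * card U") (auto simp: N_def)
      ultimately show ?thesis using overfull[of h] True by simp
    next
      case False
      then show ?thesis by (simp add: risky_def)
    qed
    finally show "(\<Sum>x\<in>U. z h x) \<le> \<nu> (length h) * card U" by (simp add: \<nu>_def N_def)
  next
    have "(\<Sum>i<T. \<nu> i) = (\<Sum>i\<in>{..<T} \<inter> I. \<epsilon> / 32)"
      unfolding \<nu>_def by (intro sum.mono_neutral_cong_right) auto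
    also have "\<dots> = card I * (\<epsilon> / 32)" using I by (simp add: Int_absorb1)
    finally show "4 * (\<Sum>i<T. \<nu> i) - \<epsilon> / 4 * card I \<le> - (\<epsilon> * card I / 8)" by (simp add: mult.commute)
  qed (use \<epsilon> in \<open>auto simp: z_def \<nu>_def\<close>)
  finally show ?thesis .
qed

text \<open>Collisions with later words are charged to the later word \<open>x\<close>. The hits of
  different values are disjoint, so summed over all \<open>x\<close> the contributions are at most
  \<open>card I\<close>, and a uniform draw contributes at most card I / N on average, where N is
  the size of \<open>U\<close>.\<close>

lemma early_hits_tail:
  fixes \<epsilon> :: real
  assumes \<epsilon>: "0 < \<epsilon>" and I: "I \<subseteq> {..<T}" and K: "0 < K" and T: "T \<le> \<epsilon> / 512 * card U"
  shows "measure (measure_spmf (draws G T []))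
      {xs. \<epsilon> / 8 * card I \<le> (\<Sum>j<T. card (early_hits K I R f (take j xs) (xs ! j)))}
    \<le> exp (- (card I / K * \<epsilon> / 16))"
proof -
  have finI: "finite I" using I finite_subset by blast
  define N where "N = real (card U)"
  have N: "0 < N" using card_U_pos by (simp add: N_def)
  define z :: "'a list \<Rightarrow> 'a \<Rightarrow> real" where "z h x = card (early_hits K I R f h x) / K" for h x
  define q where "q = card I / K"
  have q: "0 \<le> q" by (simp add: q_def)
  have "{xs. \<epsilon> / 8 * card I \<le> (\<Sum>j<T. card (early_hits K I R f (take j xs) (xs ! j)))}
     = {xs. \<epsilon> / 8 * q \<le> (\<Sum>j<T. z (take j xs) (xs ! j))}"
    using K by (simp add: z_def q_def sum_divide_distrib[symmetric] field_simps)
  moreover have "measure (measure_spmf (draws G T [])) {xs. \<epsilon> / 8 * q \<le> (\<Sum>j<T. z (take j xs) (xs ! j))}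
    \<le> exp (- (q * \<epsilon> / 16))"
  proof (rule chernoff_unit[where z = z and \<nu> = "\<lambda>_. q / N"])
    fix h :: "'a list" and x
    show "0 \<le> z h x \<and> z h x \<le> 1"
      using K card_few_predecessors_le[OF finite_hits[OF finI], of R f h x K] by (simp add: z_def early_hits_def)
    have "(\<Sum>x\<in>U. card (early_hits K I R f h x)) \<le> (\<Sum>x\<in>U. card (hits I R f h x))"
      using finI by (intro sum_mono card_mono) (auto simp: early_hits_def finite_hits)
    also have "\<dots> \<le> card I" by (rule sum_card_hits_le[OF finI finite_U])
    finally have "real (\<Sum>x\<in>U. card (early_hits K I R f h x)) / K \<le> q"
      unfolding q_def by (intro divide_right_mono) (auto simp del: of_nat_sum)
    then show "(\<Sum>x\<in>U. z h x) \<le> q / N * card U"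
      using N by (simp add: z_def sum_divide_distrib N_def)
  next
    have "4 * (T * (q / N)) \<le> 4 * (\<epsilon> / 512 * N * (q / N))"
      using T q N by (intro mult_left_mono mult_right_mono) (auto simp: N_def)
    also have "\<dots> = \<epsilon> * q / 128" using N by simp
    also have "\<dots> \<le> \<epsilon> * q / 16" using \<epsilon> q by (intro divide_left_mono) auto
    finally show "4 * (\<Sum>i<T. q / N) - \<epsilon> / 8 * q \<le> - (q * \<epsilon> / 16)"
      by (simp only: sum_constant card_lessThan mult.commute[of q])
  qed (use q N in auto)
  ultimately show ?thesis by (simp add: q_def)
qed

text \<open>Suppose the image of word \<open>i\<close> is word \<open>j\<close>. If j < i, then
  \<open>i\<close> is risky as long as the preimage mass is small. The case j = i is excluded by
  \<open>moved\<close>. If j > i, then either \<open>i\<close> is risky through the cap or it is an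
  early hit of word \<open>j\<close>. The thresholds \<epsilon> / 4 and \<epsilon> / 8 add up to 3
  \<epsilon> / 8.\<close>

lemma collision_tail:
  fixes r \<epsilon> :: real
  assumes R: "R \<subseteq> U" and moved: "\<And>u. u \<in> R \<Longrightarrow> f u \<noteq> u"
    and light: "\<And>y. card {u \<in> R. f u = y} * r \<le> card U"
    and r: "0 < (r::real)" and \<epsilon>: "0 < \<epsilon>" and I: "I \<subseteq> {..<T}"
    and T: "T \<le> \<epsilon> / 512 * card U"
    and K: "64 * card I \<le> r * \<epsilon> * real K" "0 < K"
  shows "measure (measure_spmf (draws G T []))
      {xs. 3 / 8 * \<epsilon> * card I \<le> card {i \<in> I. xs ! i \<in> R \<and> f (xs ! i) \<in> set xs}}
    \<le> exp (- (r * \<epsilon> / 128)) + exp (- (\<epsilon> * card I / 8)) + exp (- (card I / K * \<epsilon> / 16))"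
proof -
  have finI: "finite I" using I finite_subset by blast
  have finR: "finite R" using R finite_U finite_subset by blast
  let ?m = "measure (measure_spmf (draws G T []))"
  let ?A = "{xs. \<epsilon> / 64 * card U \<le> card {u \<in> R. f u \<in> set xs}}"
  let ?B = "{xs. \<epsilon> / 4 * card I \<le> card {i \<in> I. risky K I R f \<epsilon> (take i xs) (xs ! i)}}"
  let ?C = "{xs. \<epsilon> / 8 * card I \<le> (\<Sum>j<T. card (early_hits K I R f (take j xs) (xs ! j)))}"
  have "?m {xs. 3 / 8 * \<epsilon> * card I \<le> card {i \<in> I. xs ! i \<in> R \<and> f (xs ! i) \<in> set xs}} \<le> ?m (?A \<union> ?B \<union> ?C)"
  proof (rule measure_draws_mono, rule ccontr)
    fix xs :: "'a list" assume len: "length xs = T"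
      and bad: "xs \<in> {xs. 3 / 8 * \<epsilon> * card I \<le> card {i \<in> I. xs ! i \<in> R \<and> f (xs ! i) \<in> set xs}}"
      and good: "xs \<notin> ?A \<union> ?B \<union> ?C"
    let ?risky = "{i \<in> I. risky K I R f \<epsilon> (take i xs) (xs ! i)}"
    let ?early = "\<Union>j<T. early_hits K I R f (take j xs) (xs ! j)"
    have "{i \<in> I. xs ! i \<in> R \<and> f (xs ! i) \<in> set xs} \<subseteq> ?risky \<union> ?early"
    proof
      fix i assume "i \<in> {i \<in> I. xs ! i \<in> R \<and> f (xs ! i) \<in> set xs}"
      then have i: "i \<in> I" "xs ! i \<in> R" "f (xs ! i) \<in> set xs" by auto
      have iT: "i < T" using i I by auto
      let ?h = "take i xs"
      have lh: "length ?h = i" using iT len by simp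
      show "i \<in> ?risky \<union> ?early"
      proof (cases "i \<in> ?risky")
        case False
        have "card {u \<in> R. f u \<in> set ?h} \<le> card {u \<in> R. f u \<in> set xs}"
          using finR by (intro card_mono) (auto dest: in_set_takeD)
        then have mass: "card {u \<in> R. f u \<in> set ?h} < \<epsilon> / 64 * card U"
          using good by (simp add: not_le)
        have nr: "f (xs ! i) \<notin> set ?h" "card (hits I R f ?h (f (xs ! i))) < K"
          using False mass i lh by (auto simp: risky_def)
        obtain j where j: "j < T" "f (xs ! i) = xs ! j"
          using i len by (auto simp: in_set_conv_nth)
        have "\<not> j < i" using nr(1) j len iT lh by (metis in_set_conv_nth nth_take)
        moreover have "j \<noteq> i" using moved[OF i(2)] j by auto
        ultimately have ij: "i < j" by simp
        have "i \<in> hits I R f (take j xs) (xs ! j)"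
          using i ij j len by (auto simp: hits_def)
        moreover have "{l \<in> hits I R f (take j xs) (xs ! j). l < i} = hits I R f ?h (f (xs ! i))"
          using hits_take[of i j xs I R f "xs ! j"] ij j len by simp
        ultimately have "i \<in> early_hits K I R f (take j xs) (xs ! j)"
          using nr(2) by (simp add: early_hits_def)
        then show ?thesis using j by blast
      qed simp
    qed
    moreover have "finite ?early"
      using finI by (auto simp: early_hits_def finite_hits)
    ultimately have "card {i \<in> I. xs ! i \<in> R \<and> f (xs ! i) \<in> set xs} \<le> card (?risky \<union> ?early)"
      using finI by (intro card_mono) auto
    also have "\<dots> \<le> card ?risky + card ?early" by (rule card_Un_le)
    also have "card ?early \<le> (\<Sum>j<T. card (early_hits K I R f (take j xs) (xs ! j)))"
      by (rule card_UN_le) simp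
    finally have "real (card {i \<in> I. xs ! i \<in> R \<and> f (xs ! i) \<in> set xs})
      \<le> card ?risky + real (\<Sum>j<T. card (early_hits K I R f (take j xs) (xs ! j)))"
      by (simp only: of_nat_add[symmetric] of_nat_le_iff)
    then show False using bad good by (simp add: not_le)
  qed
  also have "\<dots> \<le> ?m (?A \<union> ?B) + ?m ?C" by (rule measure_Un_le) auto
  also have "\<dots> \<le> ?m ?A + ?m ?B + ?m ?C"
    by (intro add_right_mono measure_Un_le) auto
  also have "\<dots> \<le> exp (- (r * \<epsilon> / 128)) + exp (- (\<epsilon> * card I / 8)) + exp (- (card I / K * \<epsilon> / 16))"
    by (intro add_mono preimage_mass_tail[OF R light r T \<epsilon>] risky_tail[OF R light r \<epsilon> I K]
        early_hits_tail[OF \<epsilon> I K(2) T])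
  finally show ?thesis .
qed

end

section \<open>Typical blocks\<close>

text \<open>For positive \<open>r\<close>, more than \<open>card U / r\<close> moved points are sent
  to \<open>y\<close>. Fixed points are left out because they form a class of their own.\<close>

definition heavy_values :: "'a set \<Rightarrow> ('a \<Rightarrow> 'a) \<Rightarrow> real \<Rightarrow> 'a set" where
  "heavy_values U f r = {y. real (card U) < real (card {u \<in> {u \<in> U. f u \<noteq> u}. f u = y}) * r}"

definition light_points :: "'a set \<Rightarrow> ('a \<Rightarrow> 'a) \<Rightarrow> real \<Rightarrow> 'a set" where
  "light_points U f r = {u \<in> U. f u \<noteq> u \<and> f u \<notin> heavy_values U f r}"

text \<open>\<open>None\<close> stands for a fixed point and \<open>Some None\<close> for a light value.\<close>

definition tamper_class :: "'a set \<Rightarrow> ('a \<Rightarrow> 'a) \<Rightarrow> real \<Rightarrow> 'a \<Rightarrow> 'a option option" where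
  "tamper_class U f r u =
     (if f u = u then None else if f u \<in> heavy_values U f r then Some (Some (f u)) else Some None)"

definition tamper_classes :: "'a set \<Rightarrow> ('a \<Rightarrow> 'a) \<Rightarrow> real \<Rightarrow> 'a option option set" where
  "tamper_classes U f r = insert None (insert (Some None) (Some ` Some ` heavy_values U f r))"

definition typical_block ::
    "'a set \<Rightarrow> ('a \<Rightarrow> 'a) \<Rightarrow> real \<Rightarrow> real \<Rightarrow> nat set \<Rightarrow> 'a list \<Rightarrow> bool" where
  "typical_block U f r \<epsilon> I xs \<longleftrightarrow>
     (\<forall>B \<subseteq> tamper_classes U f r.
        card {i \<in> I. tamper_class U f r (xs ! i) \<in> B}
        \<le> card I * (card {u \<in> U. tamper_class U f r u \<in> B} / card U + \<epsilon> / 8)) \<and>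
     card {i \<in> I. xs ! i \<in> light_points U f r \<and> f (xs ! i) \<in> set xs} \<le> 3 / 8 * \<epsilon> * card I"

lemma tamper_class_in: "tamper_class U f r u \<in> tamper_classes U f r"
  by (simp add: tamper_class_def tamper_classes_def)

lemma finite_heavy_values:
  assumes "finite U"
  shows "finite (heavy_values U f r)"
proof (rule finite_subset)
  show "heavy_values U f r \<subseteq> f ` U"
  proof
    fix y assume "y \<in> heavy_values U f r"
    then have "card {u \<in> {u \<in> U. f u \<noteq> u}. f u = y} \<noteq> 0"
      unfolding heavy_values_def by (metis (mono_tags, lifting) mem_Collect_eq mult_zero_left
          not_less of_nat_0 of_nat_0_le_iff)
    then have "{u \<in> {u \<in> U. f u \<noteq> u}. f u = y} \<noteq> {}" by (metis card.empty)
    then show "y \<in> f ` U" by blast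
  qed
qed (use assms in simp)

text \<open>The fibres over heavy values are disjoint subsets of \<open>U\<close>, each with more
  than \<open>card U / r\<close> points.\<close>

lemma card_heavy_values_le:
  fixes r :: real
  assumes "finite U" "U \<noteq> {}" "0 < r"
  shows "card (heavy_values U f r) \<le> r"
proof -
  let ?H = "heavy_values U f r"
  let ?A = "{u \<in> U. f u \<noteq> u}"
  have N: "0 < real (card U)" using assms by (simp add: card_gt_0_iff)
  have "card ?H * real (card U) = (\<Sum>y\<in>?H. real (card U))" by simp
  also have "\<dots> \<le> (\<Sum>y\<in>?H. real (card {u \<in> ?A. f u = y}) * r)"
    by (intro sum_mono) (simp add: heavy_values_def)
  also have "\<dots> = card {u \<in> ?A. f u \<in> ?H} * r"
    using sum_card_fibers[of ?A ?H f] assms finite_heavy_values[of U f r]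
    by (simp add: sum_distrib_right[symmetric] of_nat_sum[symmetric] del: of_nat_sum)
  also have "\<dots> \<le> card U * r"
    using assms by (intro mult_right_mono) (auto intro!: card_mono)
  finally show ?thesis using N by (simp add: mult.commute)
qed

lemma card_light_fiber_le:
  fixes r :: real
  assumes "finite U" "0 < r"
  shows "card {u \<in> light_points U f r. f u = y} * r \<le> card U"
proof (cases "y \<in> heavy_values U f r")
  case True
  then have "{u \<in> light_points U f r. f u = y} = {}" by (auto simp: light_points_def)
  then show ?thesis by (simp only: card.empty)
next
  case False
  have "card {u \<in> light_points U f r. f u = y} \<le> card {u \<in> {u \<in> U. f u \<noteq> u}. f u = y}"
    using assms by (intro card_mono) (auto simp: light_points_def)
  then have "card {u \<in> light_points U f r. f u = y} * r \<le> card {u \<in> {u \<in> U. f u \<noteq> u}. f u = y} * r"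
    using assms by (intro mult_right_mono) auto
  then show ?thesis using False by (simp add: heavy_values_def)
qed

context sequential_sampling
begin

text \<open>The union runs over sets of classes and not over single classes, so that the deviation
  does not add up when many classes are merged into one event.\<close>

lemma class_counts_tail:
  fixes \<epsilon> :: real
  assumes I: "I \<subseteq> {..<T}" and \<epsilon>: "0 < \<epsilon>" "\<epsilon> \<le> 1" and \<kappa>\<epsilon>: "\<kappa> \<le> \<epsilon> / 64" and C: "finite C"
  shows "measure (measure_spmf (draws G T []))
      {xs. \<exists>B\<subseteq>C. card I * (card {u \<in> U. g u \<in> B} / card U + \<epsilon> / 8) < card {i \<in> I. g (xs ! i) \<in> B}}
    \<le> 2 ^ card C * exp (- (\<epsilon>\<^sup>2 * card I / 1024))"
proof -
  let ?m = "measure (measure_spmf (draws G T []))"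
  let ?S = "\<lambda>B. {u \<in> U. g u \<in> B}"
  let ?X = "\<lambda>B. {xs. card I * (card (?S B) / card U + \<epsilon> / 8) \<le> card {i \<in> I. xs ! i \<in> ?S B}}"
  have "?m {xs. \<exists>B\<subseteq>C. card I * (card (?S B) / card U + \<epsilon> / 8) < card {i \<in> I. g (xs ! i) \<in> B}}
    \<le> ?m (\<Union>B\<in>Pow C. ?X B)"
  proof (rule measure_draws_mono)
    fix xs :: "'a list" assume len: "length xs = T" "set xs \<subseteq> U"
      and "xs \<in> {xs. \<exists>B\<subseteq>C. card I * (card (?S B) / card U + \<epsilon> / 8) < card {i \<in> I. g (xs ! i) \<in> B}}"
    then obtain B where B: "B \<subseteq> C"
      "card I * (card (?S B) / card U + \<epsilon> / 8) < card {i \<in> I. g (xs ! i) \<in> B}" by blast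
    have "{i \<in> I. g (xs ! i) \<in> B} = {i \<in> I. xs ! i \<in> ?S B}"
      using I len by (auto intro!: subsetD[OF len(2)])
    then have "xs \<in> ?X B" using B(2) by simp
    then show "xs \<in> (\<Union>B\<in>Pow C. ?X B)" using B(1) by blast
  qed
  also have "\<dots> \<le> (\<Sum>B\<in>Pow C. ?m (?X B))"
    using C by (intro measure_UNION_le) auto
  also have "\<dots> \<le> (\<Sum>B\<in>Pow C. exp (- (\<epsilon>\<^sup>2 * card I / 1024)))"
    by (intro sum_mono block_count_tail[OF I _ \<epsilon> \<kappa>\<epsilon>]) auto
  also have "\<dots> = 2 ^ card C * exp (- (\<epsilon>\<^sup>2 * card I / 1024))"
    using C by (simp add: card_Pow)
  finally show ?thesis .
qed

text \<open>One exponential comes from the class counts and three from the collisions. The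
  parameters \<open>r\<close>, \<open>K\<close> and the size of the block are balanced so that every
  exponent is at least 8 L.\<close>

lemma not_typical_block_prob:
  fixes r \<epsilon> :: real
  assumes I: "I \<subseteq> {..<T}" and \<epsilon>: "0 < \<epsilon>" "\<epsilon> \<le> 1" and \<kappa>\<epsilon>: "\<kappa> \<le> \<epsilon> / 64"
    and T: "T \<le> \<epsilon> / 512 * card U" and L: "1 \<le> L"
    and t: "2 ^ 26 * L / \<epsilon> ^ 4 \<le> card I" and r_def: "r = 2 ^ 14 * L / \<epsilon>\<^sup>2"
  shows "measure (measure_spmf (draws G T [])) {xs. \<not> typical_block U f r \<epsilon> I xs}
    \<le> 4 * exp (- 8 * L)"
proof -
  let ?m = "measure (measure_spmf (draws G T []))"
  let ?H = "heavy_values U f r"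
  let ?C = "tamper_classes U f r"
  let ?R = "light_points U f r"
  define t where "t = real (card I)"
  have e2: "0 < \<epsilon>\<^sup>2" "\<epsilon>\<^sup>2 \<le> 1" using \<epsilon> by (auto simp: power_le_one)
  define x where "x = L / \<epsilon>\<^sup>2"
  have "L * 1 \<le> L / \<epsilon>\<^sup>2" using e2 L by (simp add: pos_le_divide_eq)
  then have x: "L \<le> x" by (simp add: x_def)
  have r: "r = 16384 * x" "0 < r" using r_def L e2 by (auto simp: x_def)
  have rL: "r * \<epsilon>\<^sup>2 = 16384 * L" using \<epsilon> by (simp add: r_def)
  have te: "67108864 * x \<le> \<epsilon>\<^sup>2 * t"
  proof -
    have "2 ^ 26 * L / \<epsilon> ^ 4 * \<epsilon>\<^sup>2 \<le> t * \<epsilon>\<^sup>2"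
      using t e2 unfolding t_def by (intro mult_right_mono) auto
    moreover have "2 ^ 26 * L / \<epsilon> ^ 4 * \<epsilon>\<^sup>2 = 2 ^ 26 * x"
      using \<epsilon> by (simp add: x_def field_simps power_add[symmetric])
    ultimately show ?thesis by (simp add: mult.commute)
  qed
  have tpos: "0 < t"
  proof -
    have "0 < \<epsilon>\<^sup>2 * t" using te x L by linarith
    then show ?thesis using e2 by (simp add: zero_less_mult_iff)
  qed
  have e1: "\<epsilon>\<^sup>2 \<le> \<epsilon>" using \<epsilon> by (simp add: power2_eq_square mult_left_le)
  have te1: "67108864 * x \<le> \<epsilon> * t" using te mult_right_mono[OF e1, of t] tpos by linarith
  have re1: "16384 * L \<le> r * \<epsilon>" using rL mult_left_mono[OF e1, of r] r by linarith
  \<comment> \<open>The smallest cap for which overfull values are rare. The quotient is at least 1,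
    so rounding up costs a factor of at most 2, hence the 128 below.\<close>
  define K where "K = nat \<lceil>64 * t / (r * \<epsilon>)\<rceil>"
  have re: "0 < r * \<epsilon>" using r \<epsilon> by simp
  have "r * \<epsilon> \<le> 64 * t"
  proof -
    have "r * \<epsilon> \<le> r * 1" using r \<epsilon> by (intro mult_left_mono) auto
    also have "\<dots> \<le> 67108864 * x" using r x L by simp
    also have "\<dots> \<le> \<epsilon> * t" by (rule te1)
    also have "\<dots> \<le> 1 * t" using \<epsilon> tpos by (intro mult_right_mono) auto
    finally show ?thesis using tpos by simp
  qed
  then have q1: "1 \<le> 64 * t / (r * \<epsilon>)" using re by (simp add: pos_le_divide_eq)
  have K1: "64 * t / (r * \<epsilon>) \<le> K" unfolding K_def by linarith
  have "real (nat \<lceil>q\<rceil>) \<le> 2 * q" if "1 \<le> q" for q :: real using that by linarith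
  from this[OF q1] have "K \<le> 2 * (64 * t / (r * \<epsilon>))" by (simp add: K_def)
  then have K2: "K \<le> 128 * t / (r * \<epsilon>)" by simp
  have Kpos: "0 < K" using K1 q1 by linarith
  have K1': "64 * card I \<le> r * \<epsilon> * K" using K1 re by (simp add: t_def pos_divide_le_eq mult.commute)
  have finH: "finite ?H" by (rule finite_heavy_values[OF finite_U])
  have finC: "finite ?C" using finH by (simp add: tamper_classes_def)
  have cardC: "card ?C \<le> r + 2"
  proof -
    have "card ?C \<le> Suc (Suc (card (Some ` Some ` ?H)))"
      unfolding tamper_classes_def by (intro card_insert_le_m1 order_trans[OF card_insert_le_m1]) auto
    also have "card (Some ` Some ` ?H) = card ?H" by (simp add: card_image)
    finally show ?thesis using card_heavy_values_le[OF finite_U U_ne r(2), of f] by linarith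
  qed
  have "(2::real) \<le> exp 1" using exp_ge_add_one_self[of 1] by simp
  then have "(2::real) ^ card ?C \<le> exp 1 ^ card ?C" by (intro power_mono) auto
  also have "\<dots> = exp (card ?C)" by (simp add: exp_of_nat_mult[symmetric])
  also have "\<dots> \<le> exp (r + 2)" using cardC by simp
  finally have pow: "(2::real) ^ card ?C \<le> exp (r + 2)" .
  let ?A = "{xs. \<exists>B\<subseteq>?C. card I * (card {u \<in> U. tamper_class U f r u \<in> B} / card U + \<epsilon> / 8)
        < card {i \<in> I. tamper_class U f r (xs ! i) \<in> B}}"
  let ?B = "{xs. 3 / 8 * \<epsilon> * card I \<le> card {i \<in> I. xs ! i \<in> ?R \<and> f (xs ! i) \<in> set xs}}"
  have "?m ?A \<le> 2 ^ card ?C * exp (- (\<epsilon>\<^sup>2 * card I / 1024))"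
    by (rule class_counts_tail[OF I \<epsilon> \<kappa>\<epsilon> finC])
  also have "\<dots> \<le> exp (r + 2) * exp (- (\<epsilon>\<^sup>2 * card I / 1024))"
    by (intro mult_right_mono pow) auto
  also have "\<dots> = exp (r + 2 - \<epsilon>\<^sup>2 * t / 1024)" by (simp add: exp_add[symmetric] t_def)
  \<comment> \<open>Here the factor 2^26 in the size of the block is used: \<epsilon>^2 t / 1024 is
    at least 2^16 x, which is 4 r, and so outweighs the number of sets of classes.\<close>
  also have "\<dots> \<le> exp (- 8 * L)" using te x L r by simp
  finally have A: "?m ?A \<le> exp (- 8 * L)" .
  have "?m ?B \<le> exp (- (r * \<epsilon> / 128)) + exp (- (\<epsilon> * card I / 8)) + exp (- (card I / K * \<epsilon> / 16))"
    by (rule collision_tail[OF _ _ card_light_fiber_le[OF finite_U r(2)] r(2) \<epsilon>(1) I T K1' Kpos])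
      (auto simp: light_points_def)
  also have "\<dots> \<le> exp (- 8 * L) + exp (- 8 * L) + exp (- 8 * L)"
  proof -
    have "8 * L \<le> r * \<epsilon> / 128" using re1 L by simp
    moreover have "8 * L \<le> \<epsilon> * t / 8" using te1 x L by simp
    \<comment> \<open>The constraint that fixes the constant in \<open>r\<close>: from K \<le> 128 t
      / (r \<epsilon>) the right-hand side is at least r \<epsilon>^2 / 2^11, which equals 8 L for r
      = 2^14 L / \<epsilon>^2.\<close>
    moreover have "8 * L \<le> t / K * \<epsilon> / 16"
    proof -
      have "K * (r * \<epsilon>) \<le> 128 * t" using K2 re by (simp add: pos_le_divide_eq)
      then have "r * \<epsilon> / 128 \<le> t / K" using Kpos by (simp add: field_simps)
      then have "r * \<epsilon> / 128 * \<epsilon> \<le> t / K * \<epsilon>" using \<epsilon> by (intro mult_right_mono) auto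
      moreover have "r * \<epsilon> / 128 * \<epsilon> = 128 * L" using rL by (simp add: power2_eq_square)
      ultimately have "128 * L \<le> t / K * \<epsilon>" by (simp only:)
      from divide_right_mono[OF this, of 16] show ?thesis by simp
    qed
    ultimately show ?thesis by (intro add_mono) (simp_all add: t_def)
  qed
  finally have B: "?m ?B \<le> 3 * exp (- 8 * L)" by simp
  have "?m {xs. \<not> typical_block U f r \<epsilon> I xs} \<le> ?m (?A \<union> ?B)"
    by (rule measure_draws_mono) (force simp: typical_block_def not_le)
  also have "\<dots> \<le> ?m ?A + ?m ?B" by (rule measure_Un_le) auto
  finally show ?thesis using A B by simp
qed

end

section \<open>From typical blocks to non-malleability\<close>

primrec decode_class :: "('a \<Rightarrow> bool list option) \<Rightarrow> 'a option option \<Rightarrow> tamper_result" where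
  "decode_class D None = Same"
| "decode_class D (Some c) = Decoded (case c of None \<Rightarrow> None | Some y \<Rightarrow> D y)"

context packed_code
begin

text \<open>Unless a light image meets the code, the tampered decoding is a function of the class:
  light images decode to \<open>None\<close>, heavy ones to whatever the decoder says. The count on
  the right is the same for all messages.\<close>

lemma tamper_prob_le:
  assumes b: "b < length ss"
    and typical: "typical_block (words n) f r \<epsilon> {b * t..<b * t + t} xs"
  shows "measure_pmf.prob (tamper_dist (sparse_enc E) (sparse_dec E) f (ss ! b)) A
    \<le> card {u \<in> words n. decode_class (sparse_dec E) (tamper_class (words n) f r u) \<in> A} / 2 ^ n + \<epsilon> / 2"
proof -
  let ?I = "{b * t..<b * t + t}"
  let ?cls = "tamper_class (words n) f r"
  let ?R = "light_points (words n) f r"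
  let ?dec = "decode_class (sparse_dec E)"
  let ?res = "\<lambda>w. if f w = w then Same else Decoded (sparse_dec E (f w))"
  \<comment> \<open>This set depends on the code through the decoder. That is harmless, because a
    typical block controls all sets of classes simultaneously.\<close>
  let ?B = "{c \<in> tamper_classes (words n) f r. ?dec c \<in> A}"
  let ?p = "card {u \<in> words n. ?dec (?cls u) \<in> A} / 2 ^ n"
  have sub: "{i \<in> ?I. ?res (xs ! i) \<in> A}
      \<subseteq> {i \<in> ?I. ?cls (xs ! i) \<in> ?B} \<union> {i \<in> ?I. xs ! i \<in> ?R \<and> f (xs ! i) \<in> set xs}"
  proof
    fix i assume "i \<in> {i \<in> ?I. ?res (xs ! i) \<in> A}"
    then have i: "i \<in> ?I" "?res (xs ! i) \<in> A" by auto
    have w: "xs ! i \<in> words n" using i(1) b block_index_less nth_in_words by auto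
    show "i \<in> {i \<in> ?I. ?cls (xs ! i) \<in> ?B} \<union> {i \<in> ?I. xs ! i \<in> ?R \<and> f (xs ! i) \<in> set xs}"
    proof (cases "xs ! i \<in> ?R \<and> f (xs ! i) \<in> set xs")
      case False
      then have "?res (xs ! i) = ?dec (?cls (xs ! i))"
        using w by (auto simp: tamper_class_def light_points_def dec_None)
      then show ?thesis using i tamper_class_in[of "words n" f r "xs ! i"] by simp
    qed (use i in simp)
  qed
  have "card {i \<in> ?I. ?res (xs ! i) \<in> A}
    \<le> card ({i \<in> ?I. ?cls (xs ! i) \<in> ?B} \<union> {i \<in> ?I. xs ! i \<in> ?R \<and> f (xs ! i) \<in> set xs})"
    by (intro card_mono sub) auto
  also have "\<dots> \<le> card {i \<in> ?I. ?cls (xs ! i) \<in> ?B} + card {i \<in> ?I. xs ! i \<in> ?R \<and> f (xs ! i) \<in> set xs}"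
    by (rule card_Un_le)
  finally have "real (card {i \<in> ?I. ?res (xs ! i) \<in> A})
    \<le> card {i \<in> ?I. ?cls (xs ! i) \<in> ?B} + card {i \<in> ?I. xs ! i \<in> ?R \<and> f (xs ! i) \<in> set xs}"
    by linarith
  also have "\<dots> \<le> t * (?p + \<epsilon> / 8) + 3 / 8 * \<epsilon> * t"
  proof (subst of_nat_add, rule add_mono)
    have "card {i \<in> ?I. ?cls (xs ! i) \<in> ?B}
      \<le> card ?I * (card {u \<in> words n. ?cls u \<in> ?B} / card (words n) + \<epsilon> / 8)"
      by (rule typical[unfolded typical_block_def, THEN conjunct1, rule_format]) simp
    moreover have "{u \<in> words n. ?cls u \<in> ?B} = {u \<in> words n. ?dec (?cls u) \<in> A}"
      using tamper_class_in by auto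
    ultimately show "card {i \<in> ?I. ?cls (xs ! i) \<in> ?B} \<le> t * (?p + \<epsilon> / 8)"
      by (simp only: card_words card_atLeastLessThan add_diff_cancel_left' of_nat_power of_nat_numeral)
    show "card {i \<in> ?I. xs ! i \<in> ?R \<and> f (xs ! i) \<in> set xs} \<le> 3 / 8 * \<epsilon> * t"
      using typical by (simp add: typical_block_def)
  qed
  also have "\<dots> = t * (?p + \<epsilon> / 2)" by (simp add: algebra_simps)
  finally show ?thesis
    using t_pos unfolding prob_tamper_dist[OF b] by (simp add: pos_divide_le_eq mult.commute)
qed

lemma strong_non_malleable_E:
  assumes "\<And>f b. f \<in> F \<Longrightarrow> b < length ss \<Longrightarrow> typical_block (words n) f r \<epsilon> {b * t..<b * t + t} xs"
  shows "strong_non_malleable k \<epsilon> F (sparse_enc E) (sparse_dec E)"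
  unfolding strong_non_malleable_def
proof (intro ballI impI)
  fix f s1 s2 assume f: "f \<in> F" and s: "s1 \<in> words k" "s2 \<in> words k"
  let ?\<mu> = "\<lambda>A. card {u \<in> words n. decode_class (sparse_dec E) (tamper_class (words n) f r u) \<in> A} / 2 ^ n"
  obtain b1 where b1: "b1 < length ss" "s1 = ss ! b1" using block_of[OF s(1)] .
  obtain b2 where b2: "b2 < length ss" "s2 = ss ! b2" using block_of[OF s(2)] .
  show "tv_dist (tamper_dist (sparse_enc E) (sparse_dec E) f s1) (tamper_dist (sparse_enc E) (sparse_dec E) f s2) \<le> \<epsilon>"
  proof (rule tv_dist_le[where \<mu> = ?\<mu>])
    fix A :: "tamper_result set"
    let ?g = "\<lambda>u. decode_class (sparse_dec E) (tamper_class (words n) f r u)"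
    have "card {u \<in> words n. ?g u \<in> A} + card {u \<in> words n. ?g u \<in> - A} = card (words n)"
      by (subst card_Un_disjoint[symmetric]) (auto simp: finite_words intro!: arg_cong[of _ _ card])
    then have "real (card {u \<in> words n. ?g u \<in> A}) + card {u \<in> words n. ?g u \<in> - A} = 2 ^ n"
      unfolding card_words of_nat_add[symmetric] by simp
    then show "?\<mu> A + ?\<mu> (- A) = 1" by (simp add: add_divide_distrib[symmetric])
  qed (use tamper_prob_le assms f b1 b2 in auto)
qed

end

section \<open>Success probability\<close>

lemma binary_entropy_nonneg:
  assumes "0 \<le> \<delta>" "\<delta> < 1/2"
  shows "0 \<le> binary_entropy \<delta>"
proof -
  have "\<delta> * log 2 \<delta> \<le> 0"
    using assms by (cases "\<delta> = 0") (auto simp: mult_le_0_iff)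
  moreover have "(1 - \<delta>) * log 2 (1 - \<delta>) \<le> 0"
    using assms by (auto simp: mult_le_0_iff)
  ultimately show ?thesis by (simp add: binary_entropy_def)
qed

lemma length_message_order: "message_order k ss \<Longrightarrow> length ss = 2 ^ k"
  unfolding message_order_def by (metis card_words distinct_card)

lemma packed_code_draws:
  fixes \<delta> :: real
  assumes "0 < t" "k \<le> n" "0 \<le> \<delta>" "message_order k ss"
    and xs: "xs \<in> set_spmf (draws (pool n (\<delta> * n)) (t * length ss) [])"
  shows "packed_code n k t \<delta> ss xs"
proof unfold_locales
  note s = draws_support[OF xs]
  show "length xs = t * length ss" using s(1) by simp
  show "set xs \<subseteq> words n" using s(3) by (force simp: set_conv_nth pool_def)
  fix i j assume ij: "i < j" "j < length xs"
  then have "xs ! i \<in> set (take j xs)" by (metis in_set_conv_nth length_take min.absorb4 nth_take)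
  then show "xs ! j \<notin> hamming_ball n (\<delta> * n) (xs ! i)"
    using s(3)[of j] ij by (auto simp: pool_def)
qed (use assms in auto)

text \<open>Before each of the \<open>T\<close> draws fewer than \<open>T\<close> balls have been
  removed, and each has volume at most 2^(n h(\<delta>)).\<close>

lemma sequential_sampling_pool:
  fixes \<delta> \<kappa> :: real and T :: nat
  assumes \<delta>: "0 \<le> \<delta>" "\<delta> < 1/2" and T: "T * 2 powr (n * binary_entropy \<delta>) \<le> \<kappa> * 2 ^ n" and \<kappa>: "\<kappa> \<le> 1/2"
  shows "sequential_sampling (words n) (pool n (\<delta> * n)) T \<kappa>"
proof unfold_locales
  let ?V = "2 powr (n * binary_entropy \<delta>)"
  show "words n \<noteq> {}" using card_words[of n] by (metis card.empty power_not_zero zero_neq_numeral)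
  have "0 \<le> T * ?V" by simp
  then have "0 \<le> \<kappa> * 2 ^ n" using T by linarith
  then show "0 \<le> \<kappa>" using zero_le_mult_iff[of \<kappa> "2 ^ n"] zero_less_power[of "2::real" n] by linarith
  fix h :: "bool list list" assume h: "set h \<subseteq> words n" "length h < T"
  let ?B = "\<Union>w\<in>set h. hamming_ball n (\<delta> * n) w"
  have "card ?B \<le> (\<Sum>w\<in>set h. card (hamming_ball n (\<delta> * n) w))"
    by (rule card_UN_le) simp
  then have "real (card ?B) \<le> (\<Sum>w\<in>set h. real (card (hamming_ball n (\<delta> * n) w)))"
    unfolding of_nat_sum[symmetric] by (rule of_nat_mono)
  also have "\<dots> \<le> (\<Sum>w\<in>set h. ?V)"
    using h \<delta> by (intro sum_mono card_hamming_ball_le) auto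
  also have "\<dots> = card (set h) * ?V" by simp
  also have "\<dots> \<le> T * ?V"
    using h card_length[of h] by (intro mult_right_mono) auto
  finally have "real (card ?B) \<le> \<kappa> * 2 ^ n" using T by linarith
  moreover have "2 ^ n - card ?B \<le> card (pool n (\<delta> * n) h)"
    unfolding pool_def card_words[symmetric] by (intro diff_card_le_card_Diff finite_subset[OF _ finite_words[of n]])
      (auto simp: hamming_ball_def)
  then have "real (2 ^ n) \<le> real (card ?B + card (pool n (\<delta> * n) h))"
    unfolding of_nat_le_iff by linarith
  ultimately show "(1 - \<kappa>) * card (words n) \<le> card (pool n (\<delta> * n) h)"
    by (simp add: card_words algebra_simps)
qed (use \<kappa> finite_words in \<open>auto simp: pool_def\<close>)

text \<open>Correct decoding and the distance hold on every completed run, so only non-malleability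
  remains a random event.\<close>

lemma success_prob_conv_draws:
  fixes \<delta> :: real
  assumes "0 < t" "k \<le> n" "0 \<le> \<delta>" "message_order k ss"
  shows "success_prob n k t \<delta> ss F \<epsilon> = measure (measure_spmf (draws (pool n (\<delta> * n)) (t * length ss) []))
    {xs. strong_non_malleable k \<epsilon> F (sparse_enc (blocks t ss xs)) (sparse_dec (blocks t ss xs))}"
proof -
  have "coding_scheme n k (sparse_enc (blocks t ss xs)) (sparse_dec (blocks t ss xs))"
    "has_relative_distance n k \<delta> (sparse_enc (blocks t ss xs)) (sparse_dec (blocks t ss xs))"
    if "xs \<in> set_spmf (draws (pool n (\<delta> * n)) (t * length ss) [])" for xs
    using packed_code.coding_scheme_E[OF packed_code_draws[OF assms that]]
      packed_code.has_relative_distance_E[OF packed_code_draws[OF assms that]] by auto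
  then show ?thesis
    unfolding success_prob_def sparse_construction_conv_draws measure_map_spmf
    by (intro measure_spmf.finite_measure_eq_AE) (auto simp: AE_measure_spmf_iff)
qed

text \<open>Serves the degenerate cases, where non-malleability is automatic and the only possible
  loss of mass is a run that exhausts the pool.\<close>

lemma success_prob_eq_1:
  assumes "0 < t" "k \<le> n" "0 \<le> \<delta>" "message_order k ss"
    and lossless: "lossless_spmf (sparse_construction n \<delta> t ss)"
    and snm: "\<And>Enc Dec. strong_non_malleable k \<epsilon> F Enc Dec"
  shows "success_prob n k t \<delta> ss F \<epsilon> = 1"
  using lossless unfolding success_prob_conv_draws[OF assms(1-4)] sparse_construction_conv_draws
  by (simp add: snm lossless_spmf_def weight_spmf_def measure_map_spmf)

lemma lossless_sparse_construction:
  assumes "0 \<le> \<delta>" "\<delta> < 1/2" "message_order k ss"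
    and "real (t * 2 ^ k) * 2 powr (n * binary_entropy \<delta>) \<le> 1/2 * 2 ^ n"
  shows "lossless_spmf (sparse_construction n \<delta> t ss)"
proof -
  interpret sequential_sampling "words n" "pool n (\<delta> * n)" "t * length ss" "1/2"
    using assms by (intro sequential_sampling_pool) (auto simp: length_message_order)
  show ?thesis using lossless_draws[of "[]" "t * length ss"]
    by (simp add: sparse_construction_conv_draws)
qed

text \<open>Union bound over the card F * 2^k pairs of a function and a block. Each block fails with
  probability at most 4 exp(-8 L), which is below 2^(-L) because L \<ge> 1, and 2^L is exactly card
  F * 2^n / \<eta>.\<close>

lemma success_prob_ge:
  assumes t: "0 < t" and k: "k \<le> n" "0 < n" and \<delta>: "0 \<le> \<delta>" "\<delta> < 1/2" and order: "message_order k ss"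
    and \<epsilon>: "0 < \<epsilon>" "\<epsilon> \<le> 1" and \<eta>: "0 < \<eta>" "\<eta> < 1" and F: "finite F" "F \<noteq> {}"
    and L_def: "L = log 2 (real (card F) * 2 ^ n / \<eta>)" and tL: "2 ^ 26 * L / \<epsilon> ^ 4 \<le> t"
    and T: "real (t * 2 ^ k) * 2 powr (n * binary_entropy \<delta>) \<le> \<epsilon> / 512 * 2 ^ n"
  shows "1 - \<eta> \<le> success_prob n k t \<delta> ss F \<epsilon>"
proof -
  let ?G = "pool n (\<delta> * n)"
  let ?T = "t * length ss"
  define \<kappa> where "\<kappa> = \<epsilon> / 512"
  have len: "length ss = 2 ^ k" by (rule length_message_order[OF order])
  interpret sequential_sampling "words n" ?G ?T \<kappa>
    using T \<delta> \<epsilon> by (intro sequential_sampling_pool) (auto simp: len \<kappa>_def)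
  let ?m = "measure (measure_spmf (draws ?G ?T []))"
  define M where "M = real (card F)"
  have M: "1 \<le> M" using F by (simp add: M_def Suc_le_eq card_gt_0_iff)
  have "2 powr 1 \<le> (2::real) ^ n" using k by (simp add: self_le_power)
  also have "\<dots> \<le> M * 2 ^ n / \<eta>"
  proof -
    have "\<eta> * 2 ^ n \<le> M * 2 ^ n" using M \<eta> by (intro mult_right_mono) auto
    then show ?thesis using \<eta> by (simp add: pos_le_divide_eq mult.commute)
  qed
  finally have two: "2 powr 1 \<le> M * 2 ^ n / \<eta>" .
  then have pos: "0 < M * 2 ^ n / \<eta>" using M \<eta> by simp
  have L: "1 \<le> L" unfolding L_def using two pos by (subst le_log_iff) (auto simp: M_def)
  have pL: "2 powr L = M * 2 ^ n / \<eta>" using pos by (simp add: L_def M_def)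
  define r where "r = 2 ^ 14 * L / \<epsilon>\<^sup>2"
  define I where "I b = {b * t..<b * t + t}" for b
  define bad where "bad f b = {xs. \<not> typical_block (words n) f r \<epsilon> (I b) xs}" for f b
  have "real (t * 2 ^ k) * 1 \<le> real (t * 2 ^ k) * 2 powr (n * binary_entropy \<delta>)"
    using binary_entropy_nonneg[OF \<delta>] by (intro mult_left_mono ge_one_powr_ge_zero) auto
  then have Tle: "?T \<le> \<epsilon> / 512 * card (words n)" using T by (simp add: len card_words)
  have bad: "?m (bad f b) \<le> 4 * exp (- 8 * L)" if "b < length ss" for f b
    unfolding bad_def
  proof (rule not_typical_block_prob)
    have "b * t + t \<le> t * length ss"
      using that by (metis Suc_leI add.commute mult.commute mult_Suc mult_le_mono1)
    then show "I b \<subseteq> {..<?T}" by (auto simp: I_def)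
    show "2 ^ 26 * L / \<epsilon> ^ 4 \<le> card (I b)" using tL by (simp add: I_def)
  qed (use \<epsilon> L Tle in \<open>auto simp: \<kappa>_def r_def\<close>)
  have "?m (- {xs. strong_non_malleable k \<epsilon> F (sparse_enc (blocks t ss xs)) (sparse_dec (blocks t ss xs))})
     \<le> ?m (\<Union>p\<in>F \<times> {..<length ss}. bad (fst p) (snd p))"
  proof (rule measure_draws_mono)
    fix xs assume xs: "xs \<in> set_spmf (draws ?G ?T [])"
      and n: "xs \<in> - {xs. strong_non_malleable k \<epsilon> F (sparse_enc (blocks t ss xs)) (sparse_dec (blocks t ss xs))}"
    interpret packed_code n k t \<delta> ss xs
      by (rule packed_code_draws[OF t k(1) \<delta>(1) order xs])
    obtain f b where "f \<in> F" "b < length ss" "\<not> typical_block (words n) f r \<epsilon> {b * t..<b * t + t} xs"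
      using strong_non_malleable_E[of F r \<epsilon>] n by blast
    then show "xs \<in> (\<Union>p\<in>F \<times> {..<length ss}. bad (fst p) (snd p))"
      by (force simp: bad_def I_def)
  qed
  also have "\<dots> \<le> (\<Sum>p\<in>F \<times> {..<length ss}. ?m (bad (fst p) (snd p)))"
    using F by (intro measure_UNION_le) auto
  also have "\<dots> \<le> (\<Sum>p\<in>F \<times> {..<length ss}. 4 * exp (- 8 * L))"
    by (intro sum_mono bad) auto
  also have "\<dots> = M * 2 ^ k * (4 * exp (- 8 * L))" by (simp add: M_def len card_cartesian_product)
  also have "\<dots> \<le> M * 2 ^ n * (2 powr (- L))"
  proof (intro mult_mono)
    have "(4::real) \<le> exp 1 * exp 1"
      using mult_mono[of 2 "exp 1" 2 "exp (1::real)"] exp_ge_add_one_self[of 1] by simp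
    also have "\<dots> = exp 2" by (simp add: exp_add[symmetric])
    finally have "4 * exp (- 8 * L) \<le> exp 2 * exp (- 8 * L)" by (intro mult_right_mono) auto
    also have "\<dots> = exp (2 - 8 * L)" by (simp add: exp_add[symmetric])
    also have "\<dots> \<le> exp (- (L * ln 2))"
    proof -
      have "L * ln 2 \<le> L * 1" using L ln_2_less_1 by (intro mult_left_mono) auto
      then have "2 - 8 * L \<le> - (L * ln 2)" using L by linarith
      then show ?thesis by simp
    qed
    finally show "4 * exp (- 8 * L) \<le> 2 powr (- L)" by (simp add: powr_def)
    show "(2::real) ^ k \<le> 2 ^ n" using k by (intro power_increasing) auto
  qed (use M in auto)
  also have "\<dots> = \<eta>" using pL pos \<eta> M by (simp add: powr_minus field_simps)
  finally have "?m (- {xs. strong_non_malleable k \<epsilon> F (sparse_enc (blocks t ss xs)) (sparse_dec (blocks t ss xs))}) \<le> \<eta>" .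
  \<comment> \<open>In a subprobability space this needs total mass 1, that is, a run that never
    fails.\<close>
  moreover have "?m (- S) = 1 - ?m S" for S
    using lossless_draws[of "[]" ?T] measure_spmf.finite_measure_compl[of S "draws ?G ?T []"]
    by (simp add: Compl_eq_Diff_UNIV lossless_spmf_def weight_spmf_def space_measure_spmf)
  ultimately show ?thesis
    unfolding success_prob_conv_draws[OF t k(1) \<delta>(1) order] by simp
qed

section \<open>The parameters of the theorem\<close>

definition min_codewords :: "nat \<Rightarrow> nat \<Rightarrow> real \<Rightarrow> real \<Rightarrow> real" where
  "min_codewords n M \<epsilon> \<eta> = 2 ^ 26 * (1 / \<epsilon> ^ 6 * log 2 (real M * 2 ^ n / \<eta>))"

text \<open>The final 9 is log 512: the condition on \<open>k\<close> says that the balls around all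
  codewords, each counted with volume 2^(n h(\<delta>)), fill at most a fraction \<epsilon>^3 / 512
  of the space.\<close>

definition max_message_length :: "nat \<Rightarrow> nat \<Rightarrow> real \<Rightarrow> real \<Rightarrow> real" where
  "max_message_length n t \<delta> \<epsilon> = real n * (1 - binary_entropy \<delta>) - log 2 (real t) - 3 * log 2 (1 / \<epsilon>) - 9"

lemma density_le:
  assumes t: "0 < t" and \<epsilon>: "0 < \<epsilon>" "\<epsilon> \<le> 1" and k: "real k \<le> max_message_length n t \<delta> \<epsilon>"
  shows "real (t * 2 ^ k) * 2 powr (n * binary_entropy \<delta>) \<le> \<epsilon> / 512 * 2 ^ n"
proof -
  have "real (t * 2 ^ k) * 2 powr (n * binary_entropy \<delta>)
      = 2 powr (log 2 t + k + n * binary_entropy \<delta>)"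
    using t by (simp add: powr_add powr_realpow)
  also have "\<dots> \<le> 2 powr (n + (3 * log 2 \<epsilon> + (- 9)))"
    using k \<epsilon> by (intro powr_mono) (auto simp: max_message_length_def log_divide algebra_simps)
  also have "\<dots> = 2 ^ n * (\<epsilon> ^ 3 / 512)"
  proof -
    have "2 powr (3 * log 2 \<epsilon>) = (2 powr log 2 \<epsilon>) powr 3" by (simp add: powr_powr mult.commute)
    also have "\<dots> = \<epsilon> ^ 3" using \<epsilon> by simp
    finally show ?thesis by (simp add: powr_add powr_realpow powr_diff)
  qed
  also have "\<dots> \<le> 2 ^ n * (\<epsilon> ^ 1 / 512)"
    using \<epsilon> by (intro mult_left_mono divide_right_mono power_decreasing) auto
  finally show ?thesis by (simp add: mult.commute)
qed

lemma finite_tampering_family: "tampering_family n F \<Longrightarrow> finite F"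
  unfolding tampering_family_def by (meson finite_PiE finite_subset finite_words)

text \<open>For \<open>\<epsilon> > 1\<close> non-malleability is trivial, but the bound on
  \<open>k\<close> no longer keeps the pool from running out, which is where losslessness enters. An
  empty family has logarithm value 0 and is treated apart, as the union bound needs a nonempty
  one.\<close>

lemma success_prob_ge_main:
  assumes adm: "admissible n k t" and \<delta>: "0 \<le> \<delta>" "\<delta> < 1/2" and \<epsilon>: "0 < \<epsilon>" and \<eta>: "0 < \<eta>"
    and F: "tampering_family n F" and order: "message_order k ss"
    and loss: "\<epsilon> \<le> 1 \<or> lossless_spmf (sparse_construction n \<delta> t ss)"
    and t: "min_codewords n (card F) \<epsilon> \<eta> \<le> t" and k: "real k \<le> max_message_length n t \<delta> \<epsilon>"
  shows "1 - \<eta> \<le> success_prob n k t \<delta> ss F \<epsilon>"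
proof -
  have a: "0 < k" "k \<le> n" "0 < t" using adm by (auto simp: admissible_def)
  have finF: "finite F" by (rule finite_tampering_family[OF F])
  consider "1 \<le> \<eta>" | "\<eta> < 1" "1 < \<epsilon>" | "\<eta> < 1" "\<epsilon> \<le> 1" "F = {}" | "\<eta> < 1" "\<epsilon> \<le> 1" "F \<noteq> {}"
    by linarith
  then show ?thesis
  proof cases
    case 1
    then show ?thesis unfolding success_prob_def by (intro order_trans[OF _ measure_nonneg]) simp
  next
    case 2
    have "strong_non_malleable k \<epsilon> F Enc Dec" for Enc Dec
      unfolding strong_non_malleable_def using 2 tv_dist_le_1 by (meson less_imp_le order_trans)
    then show ?thesis
      using success_prob_eq_1[OF a(3,2) \<delta>(1) order] loss 2 \<eta> by simp
  next
    case 3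
    have "real (t * 2 ^ k) * 2 powr (n * binary_entropy \<delta>) \<le> \<epsilon> / 512 * 2 ^ n"
      by (rule density_le[OF a(3) \<epsilon> 3(2) k])
    also have "\<dots> \<le> 1/2 * 2 ^ n" using 3 by (intro mult_right_mono) auto
    finally have "lossless_spmf (sparse_construction n \<delta> t ss)"
      by (rule lossless_sparse_construction[OF \<delta> order])
    then show ?thesis
      using success_prob_eq_1[OF a(3,2) \<delta>(1) order, of \<epsilon> F] 3 \<eta> by (simp add: strong_non_malleable_def)
  next
    case 4
    let ?L = "log 2 (real (card F) * 2 ^ n / \<eta>)"
    have "\<eta> \<le> real (card F) * 2 ^ n"
    proof -
      have "1 \<le> card F" using 4 finF by (simp add: Suc_le_eq card_gt_0_iff)
      then have "1 * 1 \<le> real (card F) * 2 ^ n" by (intro mult_mono) auto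
      then show ?thesis using 4 by linarith
    qed
    then have "0 \<le> ?L" using \<eta> by (subst zero_le_log_cancel_iff) (auto simp: pos_le_divide_eq pos_less_divide_eq)
    \<comment> \<open>The sampling argument asks for \<epsilon>^4 in the denominator; for \<epsilon>
      \<le> 1 and nonnegative L the bound with \<epsilon>^6 implies it.\<close>
    then have "2 ^ 26 * ?L / \<epsilon> ^ 4 \<le> 2 ^ 26 * ?L / \<epsilon> ^ 6"
      using 4 \<epsilon> by (intro divide_left_mono power_decreasing) auto
    also have "\<dots> \<le> t" using t by (simp add: min_codewords_def)
    finally show ?thesis
      using a 4 finF \<delta> order \<epsilon> \<eta> density_le[OF a(3) \<epsilon> 4(2) k] by (intro success_prob_ge[where L = ?L]) auto
  qed
qed

text \<open>A ball bound of 2^(n h(\<delta>)) is at least 1 since the entropy is nonnegative, so the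
  density bound also limits the bare number of codewords.\<close>

lemma admissibleI:
  assumes t: "0 < t" and k: "0 < k" and \<delta>: "0 \<le> \<delta>" "\<delta> < 1/2" and \<epsilon>: "0 < \<epsilon>" "\<epsilon> \<le> 1"
    and kle: "real k \<le> max_message_length n t \<delta> \<epsilon>"
  shows "admissible n k t"
proof -
  have "real (t * 2 ^ k) * 1 \<le> real (t * 2 ^ k) * 2 powr (n * binary_entropy \<delta>)"
    using binary_entropy_nonneg[OF \<delta>] by (intro mult_left_mono ge_one_powr_ge_zero) auto
  also have "\<dots> \<le> \<epsilon> / 512 * 2 ^ n" by (rule density_le[OF t \<epsilon> kle])
  also have "\<dots> \<le> 1 * 2 ^ n" using \<epsilon> by (intro mult_right_mono) auto
  finally have "real (t * 2 ^ k) \<le> real (2 ^ n)" by simp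
  then have tk: "t * 2 ^ k \<le> 2 ^ n" by (simp only: of_nat_le_iff)
  have "(2::nat) ^ k \<le> t * 2 ^ k" using t by simp
  then have "(2::nat) ^ k \<le> 2 ^ n" using tk by linarith
  then have "k \<le> n" by simp
  then show ?thesis using t k tk by (simp add: admissible_def)
qed

text \<open>The sum l + n inside the logarithm of \<open>t\<close> is replaced by a multiple of the
  product n l, which needs \<open>l\<close> bounded below by \<open>c\<close>; this is why the
  additive constant depends on \<open>c\<close>. The same bound absorbs the 1 from rounding
  \<open>t\<close> up. The 9 before log(1 / \<epsilon>) is 6 from \<open>t\<close> plus 3 from the
  message length, and 10 is 9 plus 1 for rounding \<open>k\<close> down.\<close>

lemma optimal_message_length_ge:
  assumes c: "0 < c" "c \<le> l" and n: "0 < n" and \<epsilon>: "0 < \<epsilon>" "\<epsilon> \<le> 1"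
    and l: "l = log 2 (M / \<eta>)" "0 < real M / \<eta>"
    and t: "0 < t" "real t \<le> min_codewords n M \<epsilon> \<eta> + 1"
    and k: "max_message_length n t \<delta> \<epsilon> \<le> real k + 1"
  shows "real n * (1 - binary_entropy \<delta>) - log 2 l - log 2 n - 9 * log 2 (1 / \<epsilon>)
      - (log 2 (2 ^ 26 * (1 / c + 1) + 1 / c) + 10) \<le> real k"
proof -
  define D where "D = 2 ^ 26 * (1 / c + 1) + 1 / c"
  have D: "0 < D" using c by (simp add: D_def add_pos_pos)
  have lpos: "0 < l" using c by simp
  have e6: "1 \<le> 1 / \<epsilon> ^ 6" using \<epsilon> by (simp add: power_le_one)
  have n1: "1 \<le> real n" using n by simp
  have log: "log 2 (real M * 2 ^ n / \<eta>) = l + n"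
  proof -
    have "log 2 (real M * 2 ^ n / \<eta>) = log 2 (real M / \<eta> * 2 ^ n)" by simp
    also have "\<dots> = log 2 (real M / \<eta>) + log 2 (2 ^ n)"
      by (rule log_mult_pos) (use l in auto)
    finally show ?thesis using l by simp
  qed
  have nl1: "1 \<le> 1 / c * (n * l)"
  proof -
    have "c * 1 \<le> l * n" using c n1 by (intro mult_mono) auto
    then show ?thesis using c by (simp add: field_simps)
  qed
  have nl: "l + n \<le> (1 / c + 1) * (n * l)"
  proof -
    have "l * 1 \<le> l * n" using lpos n1 by (intro mult_left_mono) auto
    moreover have "real n * 1 \<le> n * (l / c)" using c by (intro mult_left_mono) auto
    ultimately show ?thesis by (simp add: algebra_simps)
  qed
  have "real t \<le> 2 ^ 26 * (1 / \<epsilon> ^ 6 * (l + n)) + 1"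
    using t by (simp add: min_codewords_def log)
  also have "\<dots> \<le> 2 ^ 26 * (1 / \<epsilon> ^ 6 * ((1 / c + 1) * (n * l))) + 1 / \<epsilon> ^ 6 * (1 / c * (n * l))"
    using nl nl1 e6 mult_mono[OF e6 nl1] by (intro add_mono mult_left_mono) auto
  also have "\<dots> = D * (1 / \<epsilon> ^ 6 * (n * l))" by (simp add: D_def algebra_simps)
  finally have "log 2 t \<le> log 2 (D * (1 / \<epsilon> ^ 6 * (n * l)))"
    using t by simp
  also have "\<dots> = log 2 D + (6 * log 2 (1 / \<epsilon>) + (log 2 n + log 2 l))"
    using D \<epsilon> n lpos by (simp add: log_mult log_divide log_nat_power)
  finally show ?thesis using k by (simp add: max_message_length_def D_def)
qed

lemma rate_asymptotics:
  assumes \<alpha>: "0 < \<alpha>" and \<delta>: "0 \<le> \<delta>" "\<delta> < 1/2"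
    and pos: "0 < 1 - binary_entropy \<delta> - \<alpha>" and \<gamma>: "0 < \<gamma>"
  shows "\<exists>\<beta>>0. \<forall>\<eta>>0. \<exists>n0. \<forall>n\<ge>n0. \<forall>F.
     tampering_family n F \<and> real (card F) \<le> 2 powr (2 powr (\<alpha> * real n)) \<longrightarrow>
     (\<exists>k t. admissible n k t \<and>
        \<bar>real k / real n - (1 - binary_entropy \<delta> - \<alpha>)\<bar> \<le> \<gamma> \<and>
        (\<forall>ss. message_order k ss \<longrightarrow>
           success_prob n k t \<delta> ss F (2 powr (- \<beta> * real n)) \<ge> 1 - \<eta>))"
proof -
  define q where "q = 1 - binary_entropy \<delta> - \<alpha>"
  define g where "g = min \<gamma> q"
  have g: "0 < g" "g \<le> \<gamma>" "g \<le> q" using pos \<gamma> by (auto simp: g_def q_def)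
  \<comment> \<open>The error 2^(-\<beta> n) costs 6 \<beta> n through \<open>t\<close> and 3
    \<beta> n through the message length, together g n / 2. The other half of g n absorbs the
    constants.\<close>
  define \<beta> where "\<beta> = g / 18"
  have \<beta>: "0 < \<beta>" using g by (simp add: \<beta>_def)
  \<comment> \<open>The 3 arises since the logarithm of the family is at most 2^(\<alpha> n) and n +
    log(1 / \<eta>) is eventually at most twice that.\<close>
  define D :: real where "D = 3 * 2 ^ 26"
  have D: "1 \<le> D" by (simp add: D_def)
  show ?thesis
  proof (intro exI[of _ \<beta>] conjI \<beta> allI impI)
    fix \<eta> :: real assume \<eta>: "0 < \<eta>"
    have "eventually (\<lambda>n::nat. real n + log 2 (1 / \<eta>) \<le> 2 * 2 powr (\<alpha> * real n)) at_top"
      using \<alpha> by real_asymp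
    moreover have "eventually (\<lambda>n::nat. 2 * (log 2 D + 11) / g < real n) at_top"
      by real_asymp
    moreover have "eventually (\<lambda>n::nat. 0 < n) at_top" by (rule eventually_gt_at_top)
    ultimately have "eventually (\<lambda>n::nat. real n + log 2 (1 / \<eta>) \<le> 2 * 2 powr (\<alpha> * real n) \<and>
        2 * (log 2 D + 11) / g < real n \<and> 0 < n) at_top"
      by (intro eventually_conj)
    then obtain n0 where n0: "\<And>n::nat. n0 \<le> n \<Longrightarrow> real n + log 2 (1 / \<eta>) \<le> 2 * 2 powr (\<alpha> * real n) \<and>
        2 * (log 2 D + 11) / g < real n \<and> 0 < n"
      unfolding eventually_at_top_linorder by blast
    show "\<exists>n0. \<forall>n\<ge>n0. \<forall>F.
     tampering_family n F \<and> real (card F) \<le> 2 powr (2 powr (\<alpha> * real n)) \<longrightarrow>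
     (\<exists>k t. admissible n k t \<and>
        \<bar>real k / real n - (1 - binary_entropy \<delta> - \<alpha>)\<bar> \<le> \<gamma> \<and>
        (\<forall>ss. message_order k ss \<longrightarrow>
           success_prob n k t \<delta> ss F (2 powr (- \<beta> * real n)) \<ge> 1 - \<eta>))"
    proof (rule exI[of _ n0], intro allI impI, elim conjE)
      fix n F assume n: "n0 \<le> n" and F: "tampering_family n F" "real (card F) \<le> 2 powr (2 powr (\<alpha> * real n))"
      note nn = n0[OF n]
      define \<epsilon> where "\<epsilon> = 2 powr (- \<beta> * real n)"
      have \<epsilon>: "0 < \<epsilon>" "\<epsilon> \<le> 1"
        using \<beta> powr_mono[of "- \<beta> * real n" 0 2] by (auto simp: \<epsilon>_def)
      have log\<epsilon>: "log 2 (1 / \<epsilon>) = \<beta> * n" using \<epsilon> by (simp add: log_divide) (simp add: \<epsilon>_def)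
      have e6: "1 / \<epsilon> ^ 6 = 2 powr (6 * \<beta> * n)"
      proof -
        have "\<epsilon> ^ 6 = \<epsilon> powr 6" using \<epsilon> by simp
        also have "\<dots> = 2 powr (- (6 * \<beta> * n))"
          by (simp add: \<epsilon>_def powr_powr algebra_simps)
        finally show ?thesis by (simp add: powr_minus_divide)
      qed
      define X where "X = D * 2 powr ((6 * \<beta> + \<alpha>) * n)"
      have X: "1 \<le> X"
      proof -
        have "1 * 1 \<le> D * 2 powr ((6 * \<beta> + \<alpha>) * n)"
          using D \<alpha> \<beta> by (intro mult_mono ge_one_powr_ge_zero) auto
        then show ?thesis by (simp add: X_def)
      qed
      define t where "t = nat \<lceil>X\<rceil>"
      have t: "X \<le> t" "t \<le> 2 * X" "0 < t" using X unfolding t_def by linarith+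
      have logX: "log 2 X = log 2 D + 6 * (\<beta> * n) + \<alpha> * n"
        using D by (simp add: X_def log_mult distrib_right)
      have logt: "log 2 X \<le> log 2 t" "log 2 t \<le> log 2 X + 1"
      proof -
        show "log 2 X \<le> log 2 t" using t X by simp
        have "log 2 t \<le> log 2 (2 * X)" using t X by simp
        then show "log 2 t \<le> log 2 X + 1" using X by (simp add: log_mult)
      qed
      have tge: "min_codewords n (card F) \<epsilon> \<eta> \<le> t"
      proof (cases "F = {}")
        case True
        \<comment> \<open>For the empty family the argument of the logarithm is 0, and
          \<open>log 2 0 = 0\<close>.\<close>
        then show ?thesis by (simp add: min_codewords_def log_def)
      next
        case False
        have "finite F" by (rule finite_tampering_family[OF F(1)])
        then have M: "0 < real (card F)" using False by (simp add: card_gt_0_iff)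
        have "log 2 (card F) \<le> 2 powr (\<alpha> * n)" using F(2) M by (simp add: log_le_iff)
        moreover have "log 2 (real (card F) * 2 ^ n / \<eta>) = log 2 (card F) + (n + log 2 (1 / \<eta>))"
          using M \<eta> by (simp add: log_mult log_divide log_nat_power)
        ultimately have "log 2 (real (card F) * 2 ^ n / \<eta>) \<le> 3 * 2 powr (\<alpha> * n)" using nn by linarith
        then have "min_codewords n (card F) \<epsilon> \<eta> \<le> 2 ^ 26 * (1 / \<epsilon> ^ 6 * (3 * 2 powr (\<alpha> * n)))"
          unfolding min_codewords_def using \<epsilon> by (intro mult_left_mono) auto
        also have "\<dots> = X" unfolding e6 by (simp add: X_def D_def powr_add distrib_right)
        finally show ?thesis using t by linarith
      qed
      let ?k0 = "max_message_length n t \<delta> \<epsilon>"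
      have k0: "?k0 = n * q + \<alpha> * n - log 2 t - 3 * (\<beta> * n) - 9"
        by (simp add: max_message_length_def log\<epsilon> q_def algebra_simps)
      have logD: "0 \<le> log 2 D" using D by simp
      have gn: "g / 2 * n = 9 * (\<beta> * n)" by (simp add: \<beta>_def)
      have lower: "n * q - g / 2 * n - log 2 D - 10 \<le> ?k0"
        using logt gn unfolding k0 logX by linarith
      have upper: "?k0 \<le> n * q"
        using logt logD mult_pos_pos[OF \<beta>, of n] nn unfolding k0 logX by simp
      \<comment> \<open>The 11 is 9 from the message length, 1 from rounding \<open>t\<close> up and
        1 from rounding \<open>k\<close> down.\<close>
      have big: "log 2 D + 11 < g / 2 * n"
        using nn g by (simp add: pos_divide_less_eq mult.commute)
      have gq: "g * n \<le> n * q" using mult_right_mono[OF g(3), of n] by (simp add: mult.commute)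
      have k0pos: "1 < ?k0" using lower big gq by simp
      define k where "k = nat \<lfloor>?k0\<rfloor>"
      have k: "k \<le> ?k0" "?k0 - 1 \<le> k" "0 < k" using k0pos unfolding k_def by linarith+
      have adm: "admissible n k t" by (rule admissibleI[OF t(3) k(3) \<delta> \<epsilon> k(1)])
      have "\<bar>real k / real n - q\<bar> \<le> \<gamma>"
      proof -
        have "k \<le> n * q" using k upper by linarith
        then have "k / n \<le> q" using nn by (simp add: pos_divide_le_eq mult.commute)
        moreover have "n * (q - g) \<le> k"
          using k lower big by (simp add: algebra_simps)
        then have "q - g \<le> k / n" using nn by (simp add: pos_le_divide_eq mult.commute)
        ultimately show ?thesis using g \<gamma> by linarith
      qed
      moreover have "1 - \<eta> \<le> success_prob n k t \<delta> ss F \<epsilon>" if "message_order k ss" for ss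
        by (rule success_prob_ge_main[OF adm \<delta> \<epsilon>(1) \<eta> F(1) that _ tge k(1)]) (use \<epsilon> in simp)
      ultimately show "\<exists>k t. admissible n k t \<and>
        \<bar>real k / real n - (1 - binary_entropy \<delta> - \<alpha>)\<bar> \<le> \<gamma> \<and>
        (\<forall>ss. message_order k ss \<longrightarrow>
           success_prob n k t \<delta> ss F (2 powr (- \<beta> * real n)) \<ge> 1 - \<eta>)"
        using adm unfolding \<epsilon>_def q_def by blast
    qed
  qed
qed

theorem theorem3p1:
  "\<exists>(C1::real) (C2::real)
     (t0 :: nat \<Rightarrow> nat \<Rightarrow> real \<Rightarrow> real \<Rightarrow> real)
     (k0 :: nat \<Rightarrow> nat \<Rightarrow> real \<Rightarrow> real \<Rightarrow> real).
     0 < C1 \<and> 0 < C2 \<and>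
     (\<forall>n M \<epsilon> \<eta>. 0 < \<epsilon> \<and> 0 < \<eta> \<longrightarrow>
        t0 n M \<epsilon> \<eta> \<le> C1 * (1 / \<epsilon> ^ 6 * log 2 (real M * 2 ^ n / \<eta>))) \<and>
     (\<forall>n t \<delta> \<epsilon>. 0 < t \<and> 0 \<le> \<delta> \<and> \<delta> < 1/2 \<and> 0 < \<epsilon> \<longrightarrow>
        k0 n t \<delta> \<epsilon> \<ge>
          real n * (1 - binary_entropy \<delta>) - log 2 (real t) - 3 * log 2 (1 / \<epsilon>) - C2) \<and>
     (\<forall>n k t \<delta> \<epsilon> \<eta> F ss.
        admissible n k t \<and> 0 \<le> \<delta> \<and> \<delta> < 1/2 \<and> 0 < \<epsilon> \<and> 0 < \<eta> \<and>
        tampering_family n F \<and> message_order k ss \<and>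
        (\<epsilon> \<le> 1 \<or> lossless_spmf (sparse_construction n \<delta> t ss)) \<and>
        real t \<ge> t0 n (card F) \<epsilon> \<eta> \<and> real k \<le> k0 n t \<delta> \<epsilon> \<longrightarrow>
        success_prob n k t \<delta> ss F \<epsilon> \<ge> 1 - \<eta>) \<and>
     (\<forall>c>0. \<exists>C3. \<forall>n k t \<delta> \<epsilon> \<eta> F.
        0 < k \<and> 0 \<le> \<delta> \<and> \<delta> < 1/2 \<and> 0 < \<epsilon> \<and> \<epsilon> \<le> 1 \<and> 0 < \<eta> \<and>
        0 < n \<and> tampering_family n F \<and> F \<noteq> {} \<and> log 2 (real (card F) / \<eta>) \<ge> c \<and>
        int t = \<lceil>t0 n (card F) \<epsilon> \<eta>\<rceil> \<and> int k = \<lfloor>k0 n t \<delta> \<epsilon>\<rfloor> \<longrightarrow>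
        admissible n k t \<and>
        (\<forall>ss. message_order k ss \<longrightarrow> success_prob n k t \<delta> ss F \<epsilon> \<ge> 1 - \<eta>) \<and>
        real k \<ge> real n * (1 - binary_entropy \<delta>) - log 2 (log 2 (real (card F) / \<eta>))
                  - log 2 (real n) - 9 * log 2 (1 / \<epsilon>) - C3) \<and>
     (\<forall>\<alpha> \<delta> \<gamma>. 0 < \<alpha> \<and> \<alpha> < 1 \<and> 0 \<le> \<delta> \<and> \<delta> < 1/2 \<and>
        0 < 1 - binary_entropy \<delta> - \<alpha> \<and> 0 < \<gamma> \<longrightarrow>
        (\<exists>\<beta>>0. \<forall>\<eta>>0. \<exists>n0. \<forall>n\<ge>n0. \<forall>F.
           tampering_family n F \<and> real (card F) \<le> 2 powr (2 powr (\<alpha> * real n)) \<longrightarrow>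
           (\<exists>k t. admissible n k t \<and>
              \<bar>real k / real n - (1 - binary_entropy \<delta> - \<alpha>)\<bar> \<le> \<gamma> \<and>
              (\<forall>ss. message_order k ss \<longrightarrow>
                 success_prob n k t \<delta> ss F (2 powr (- \<beta> * real n)) \<ge> 1 - \<eta>))))"
proof (rule exI[of _ "2 ^ 26"], rule exI[of _ 9], rule exI[of _ min_codewords],
    rule exI[of _ max_message_length], intro conjI)
  show "\<forall>n k t \<delta> \<epsilon> \<eta> F ss.
        admissible n k t \<and> 0 \<le> \<delta> \<and> \<delta> < 1/2 \<and> 0 < \<epsilon> \<and> 0 < \<eta> \<and>
        tampering_family n F \<and> message_order k ss \<and>
        (\<epsilon> \<le> 1 \<or> lossless_spmf (sparse_construction n \<delta> t ss)) \<and>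
        real t \<ge> min_codewords n (card F) \<epsilon> \<eta> \<and> real k \<le> max_message_length n t \<delta> \<epsilon> \<longrightarrow>
        success_prob n k t \<delta> ss F \<epsilon> \<ge> 1 - \<eta>"
    using success_prob_ge_main by blast
  show "\<forall>c>0. \<exists>C3. \<forall>n k t \<delta> \<epsilon> \<eta> F.
        0 < k \<and> 0 \<le> \<delta> \<and> \<delta> < 1/2 \<and> 0 < \<epsilon> \<and> \<epsilon> \<le> 1 \<and> 0 < \<eta> \<and>
        0 < n \<and> tampering_family n F \<and> F \<noteq> {} \<and> log 2 (real (card F) / \<eta>) \<ge> c \<and>
        int t = \<lceil>min_codewords n (card F) \<epsilon> \<eta>\<rceil> \<and> int k = \<lfloor>max_message_length n t \<delta> \<epsilon>\<rfloor> \<longrightarrow>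
        admissible n k t \<and>
        (\<forall>ss. message_order k ss \<longrightarrow> success_prob n k t \<delta> ss F \<epsilon> \<ge> 1 - \<eta>) \<and>
        real k \<ge> real n * (1 - binary_entropy \<delta>) - log 2 (log 2 (real (card F) / \<eta>))
                  - log 2 (real n) - 9 * log 2 (1 / \<epsilon>) - C3"
  proof (intro allI impI)
    fix c :: real assume c: "0 < c"
    show "\<exists>C3. \<forall>n k t \<delta> \<epsilon> \<eta> F.
        0 < k \<and> 0 \<le> \<delta> \<and> \<delta> < 1/2 \<and> 0 < \<epsilon> \<and> \<epsilon> \<le> 1 \<and> 0 < \<eta> \<and>
        0 < n \<and> tampering_family n F \<and> F \<noteq> {} \<and> log 2 (real (card F) / \<eta>) \<ge> c \<and>
        int t = \<lceil>min_codewords n (card F) \<epsilon> \<eta>\<rceil> \<and> int k = \<lfloor>max_message_length n t \<delta> \<epsilon>\<rfloor> \<longrightarrow>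
        admissible n k t \<and>
        (\<forall>ss. message_order k ss \<longrightarrow> success_prob n k t \<delta> ss F \<epsilon> \<ge> 1 - \<eta>) \<and>
        real k \<ge> real n * (1 - binary_entropy \<delta>) - log 2 (log 2 (real (card F) / \<eta>))
                  - log 2 (real n) - 9 * log 2 (1 / \<epsilon>) - C3"
    proof (rule exI[of _ "log 2 (2 ^ 26 * (1 / c + 1) + 1 / c) + 10"], intro allI impI, elim conjE)
      fix n k t :: nat and \<delta> \<epsilon> \<eta> :: real and F
      assume k: "0 < k" and \<delta>: "0 \<le> \<delta>" "\<delta> < 1/2" and \<epsilon>: "0 < \<epsilon>" "\<epsilon> \<le> 1" and \<eta>: "0 < \<eta>"
        and n: "0 < n" and F: "tampering_family n F" "F \<noteq> {}" and cl: "c \<le> log 2 (real (card F) / \<eta>)"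
        and t: "int t = \<lceil>min_codewords n (card F) \<epsilon> \<eta>\<rceil>" and k0: "int k = \<lfloor>max_message_length n t \<delta> \<epsilon>\<rfloor>"
      have M: "0 < real (card F) / \<eta>"
        using F finite_tampering_family \<eta> by (simp add: card_gt_0_iff)
      have "log 2 (real (card F) / \<eta> * 2 ^ n) = log 2 (real (card F) / \<eta>) + log 2 (2 ^ n)"
        by (rule log_mult_pos) (use M in auto)
      then have "0 < log 2 (real (card F) / \<eta> * 2 ^ n)" using c cl by simp
      \<comment> \<open>Positivity, which rests on \<open>c > 0\<close>, makes the rounded value a
        positive number of codewords.\<close>
      then have "0 < min_codewords n (card F) \<epsilon> \<eta>" using \<epsilon> by (simp add: min_codewords_def)
      then have t': "min_codewords n (card F) \<epsilon> \<eta> \<le> t" "t \<le> min_codewords n (card F) \<epsilon> \<eta> + 1" "0 < t"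
        using t by linarith+
      have k': "k \<le> max_message_length n t \<delta> \<epsilon>" "max_message_length n t \<delta> \<epsilon> \<le> real k + 1"
        using k0 by linarith+
      have adm: "admissible n k t" by (rule admissibleI[OF t'(3) k \<delta> \<epsilon> k'(1)])
      moreover have "1 - \<eta> \<le> success_prob n k t \<delta> ss F \<epsilon>" if "message_order k ss" for ss
        by (rule success_prob_ge_main[OF adm \<delta> \<epsilon>(1) \<eta> F(1) that _ t'(1) k'(1)]) (use \<epsilon> in simp)
      ultimately show "admissible n k t \<and>
        (\<forall>ss. message_order k ss \<longrightarrow> success_prob n k t \<delta> ss F \<epsilon> \<ge> 1 - \<eta>) \<and>
        real k \<ge> real n * (1 - binary_entropy \<delta>) - log 2 (log 2 (real (card F) / \<eta>))
                  - log 2 (real n) - 9 * log 2 (1 / \<epsilon>) - (log 2 (2 ^ 26 * (1 / c + 1) + 1 / c) + 10)"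
        using optimal_message_length_ge[OF c cl n \<epsilon> refl M t'(3,2) k'(2)] by blast
    qed
  qed
qed (use rate_asymptotics in \<open>auto simp: min_codewords_def max_message_length_def\<close>)

end
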